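(* $\mathfrak{conf}(\mathbb H_3)\cong\mathfrak{su}(2,1)$ as real Lie algebras, where $\mathfrak{conf}(\mathbb H_3)$ denotes the Lie algebra of conformal sub-Riemannian vector fields of the three-dimensional Heisenberg group.
   Context: The Heisenberg group $\mathbb H_3$ is $\mathbb R^3$ with the sub-Riemannian structure whose distribution $\Delta$ has orthonormal frame $f_1=\partial_y+\frac x2\partial_z$, $f_2=\partial_x-\frac y2\partial_z$. For a vector field $Y$, let $Y^*\in C^\infty(T^*\mathbb R^3)$ be $Y^*(\lambda)=\langle\lambda,Y(\pi(\lambda))\rangle$, let $h_i=f_i^*$ and let $h=\frac12(h_1^2+h_2^2)$. The Poisson bracket on $T^*\mathbb R^3$ satisfies $\{Y^*,Z^*\}=[Y,Z]^*$ and $\{Y^*,\pi^*a\}=\pi^*(Y(a))$. A vector field $X$ is a conformal sub-Riemannian vector field if its flow preserves the conformal class of the sub-Riemannian metric, equivalently if $\{X^*,h\}=2\eta h$ for some smooth function $\eta$ on the base. $\mathfrak{su}(2,1)$ is the Lie algebra of the real Lie group $SU(2,1)$. *)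

theory Defs
  imports "HOL-Analysis.Analysis" "HOL-Library.Function_Algebras"
begin

section \<open>Real Lie algebras inside a real vector space\<close>

text \<open>Vector fields on a Euclidean space are functions; they form a real vector space
  under the pointwise operations.\<close>

instantiation "fun" :: (type, real_vector) real_vector
begin

definition scaleR_fun :: "real \<Rightarrow> ('a \<Rightarrow> 'b) \<Rightarrow> 'a \<Rightarrow> 'b"
  where "scaleR_fun c f = (\<lambda>x. c *\<^sub>R f x)"

instance
  by standard (auto simp: scaleR_fun_def fun_eq_iff scaleR_add_right scaleR_add_left)

end

lemma scaleR_fun_apply [simp]: "(c *\<^sub>R f) x = c *\<^sub>R f x"
  by (simp add: scaleR_fun_def)

definition real_lie_algebra :: "'a::real_vector set \<Rightarrow> ('a \<Rightarrow> 'a \<Rightarrow> 'a) \<Rightarrow> bool"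
  where "real_lie_algebra V br \<longleftrightarrow>
    subspace V \<and>
    (\<forall>x\<in>V. \<forall>y\<in>V. br x y \<in> V) \<and>
    (\<forall>x\<in>V. \<forall>y\<in>V. \<forall>z\<in>V. br (x + y) z = br x z + br y z) \<and>
    (\<forall>x\<in>V. \<forall>y\<in>V. \<forall>z\<in>V. br x (y + z) = br x y + br x z) \<and>
    (\<forall>c. \<forall>x\<in>V. \<forall>y\<in>V. br (c *\<^sub>R x) y = c *\<^sub>R br x y) \<and>
    (\<forall>c. \<forall>x\<in>V. \<forall>y\<in>V. br x (c *\<^sub>R y) = c *\<^sub>R br x y) \<and>
    (\<forall>x\<in>V. br x x = 0) \<and>
    (\<forall>x\<in>V. \<forall>y\<in>V. \<forall>z\<in>V. br x (br y z) + br y (br z x) + br z (br x y) = 0)"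

definition lie_algebra_isomorphic ::
  "'a::real_vector set \<Rightarrow> ('a \<Rightarrow> 'a \<Rightarrow> 'a) \<Rightarrow> 'b::real_vector set \<Rightarrow> ('b \<Rightarrow> 'b \<Rightarrow> 'b) \<Rightarrow> bool"
  where "lie_algebra_isomorphic V brV W brW \<longleftrightarrow>
    real_lie_algebra V brV \<and> real_lie_algebra W brW \<and>
    (\<exists>\<phi>. bij_betw \<phi> V W \<and>
      (\<forall>x\<in>V. \<forall>y\<in>V. \<phi> (x + y) = \<phi> x + \<phi> y) \<and>
      (\<forall>c. \<forall>x\<in>V. \<phi> (c *\<^sub>R x) = c *\<^sub>R \<phi> x) \<and>
      (\<forall>x\<in>V. \<forall>y\<in>V. \<phi> (brV x y) = brW (\<phi> x) (\<phi> y)))"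


section \<open>Smooth maps\<close>

primrec C_k :: "nat \<Rightarrow> ('a::euclidean_space \<Rightarrow> 'b::real_normed_vector) \<Rightarrow> bool" where
  "C_k 0 f \<longleftrightarrow> continuous_on UNIV f"
| "C_k (Suc n) f \<longleftrightarrow>
    (\<forall>x. f differentiable (at x)) \<and> (\<forall>v. C_k n (\<lambda>x. frechet_derivative f (at x) v))"

definition smooth :: "('a::euclidean_space \<Rightarrow> 'b::real_normed_vector) \<Rightarrow> bool"
  where "smooth f \<longleftrightarrow> (\<forall>n. C_k n f)"


section \<open>Vector fields and the cotangent bundle of three-space\<close>

type_synonym vector_field = "real^3 \<Rightarrow> real^3"

text \<open>A point of the cotangent bundle is a pair of a base point \<open>q\<close> and the coefficients
  \<open>p\<close> of a covector in the basis \<open>dx, dy, dz\<close>, so the bundle projection is \<open>fst\<close> and the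
  pairing with a tangent vector is the standard inner product.\<close>

type_synonym cotangent = "(real^3) \<times> (real^3)"

definition vf_bracket :: "vector_field \<Rightarrow> vector_field \<Rightarrow> vector_field"
  where "vf_bracket X Y =
    (\<lambda>q. frechet_derivative Y (at q) (X q) - frechet_derivative X (at q) (Y q))"

definition fibre_linear :: "vector_field \<Rightarrow> cotangent \<Rightarrow> real"
  where "fibre_linear Y = (\<lambda>(q, p). p \<bullet> Y q)"

definition base_deriv :: "3 \<Rightarrow> (cotangent \<Rightarrow> real) \<Rightarrow> cotangent \<Rightarrow> real"
  where "base_deriv i F = (\<lambda>l. frechet_derivative F (at l) (axis i 1, 0))"

definition fibre_deriv :: "3 \<Rightarrow> (cotangent \<Rightarrow> real) \<Rightarrow> cotangent \<Rightarrow> real"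
  where "fibre_deriv i F = (\<lambda>l. frechet_derivative F (at l) (0, axis i 1))"

text \<open>The sign convention is the one for which \<open>{Y\<^sup>*, Z\<^sup>*} = [Y, Z]\<^sup>*\<close> and
  \<open>{Y\<^sup>*, \<pi>\<^sup>* a} = \<pi>\<^sup>* (Y a)\<close>; both identities are proved below.\<close>

definition poisson :: "(cotangent \<Rightarrow> real) \<Rightarrow> (cotangent \<Rightarrow> real) \<Rightarrow> cotangent \<Rightarrow> real"
  where "poisson F G = (\<lambda>l. \<Sum>i\<in>UNIV.
    fibre_deriv i F l * base_deriv i G l - base_deriv i F l * fibre_deriv i G l)"

lemma frechet_derivative_fibre_linear:
  assumes "Y differentiable (at q)"
  shows "frechet_derivative (fibre_linear Y) (at (q, p)) (u, v)
    = p \<bullet> frechet_derivative Y (at q) u + v \<bullet> Y q"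
proof -
  have Y: "(Y has_derivative frechet_derivative Y (at q)) (at (fst (q, p)))"
    using assms by (simp add: frechet_derivative_works)
  have "((\<lambda>l. Y (fst l)) has_derivative (\<lambda>w. frechet_derivative Y (at q) (fst w))) (at (q, p))"
    by (rule has_derivative_compose[OF has_derivative_fst[OF has_derivative_ident] Y])
  then have "((\<lambda>l. snd l \<bullet> Y (fst l)) has_derivative
      (\<lambda>w. snd (q, p) \<bullet> frechet_derivative Y (at q) (fst w) + snd w \<bullet> Y (fst (q, p)))) (at (q, p))"
    by (intro has_derivative_inner has_derivative_snd has_derivative_ident)
  then have "(fibre_linear Y has_derivative
      (\<lambda>w. p \<bullet> frechet_derivative Y (at q) (fst w) + snd w \<bullet> Y q)) (at (q, p))"
    by (simp add: fibre_linear_def case_prod_unfold)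
  from frechet_derivative_at[OF this, symmetric] show ?thesis by simp
qed

lemma frechet_derivative_pullback:
  fixes a :: "real^3 \<Rightarrow> real"
  assumes "a differentiable (at q)"
  shows "frechet_derivative (a \<circ> fst) (at (q, p :: real^3)) (u, v) = frechet_derivative a (at q) u"
proof -
  have a: "(a has_derivative frechet_derivative a (at q)) (at (fst (q, p)))"
    using assms by (simp add: frechet_derivative_works)
  have "((\<lambda>l. a (fst l)) has_derivative (\<lambda>w. frechet_derivative a (at q) (fst w))) (at (q, p))"
    by (rule has_derivative_compose[OF has_derivative_fst[OF has_derivative_ident] a])
  from frechet_derivative_at[OF this, symmetric] show ?thesis by (simp add: o_def)
qed

lemma linear_axis_expansion:
  fixes D :: "real^3 \<Rightarrow> 'b::real_vector"
  assumes "linear D"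
  shows "(\<Sum>i\<in>UNIV. u $ i *\<^sub>R D (axis i 1)) = D u"
proof -
  have "D u = D (\<Sum>i\<in>UNIV. u $ i *\<^sub>R axis i 1)"
    by (simp add: basis_expansion scalar_mult_eq_scaleR[symmetric])
  also have "\<dots> = (\<Sum>i\<in>UNIV. u $ i *\<^sub>R D (axis i 1))"
    using assms by (simp add: linear_sum linear_cmul)
  finally show ?thesis by simp
qed

lemma poisson_fibre_linear:
  assumes "\<And>q. Y differentiable (at q)" "\<And>q. Z differentiable (at q)"
  shows "poisson (fibre_linear Y) (fibre_linear Z) = fibre_linear (vf_bracket Y Z)"
proof (rule ext, safe)
  fix q p :: "real^3"
  let ?DY = "frechet_derivative Y (at q)" and ?DZ = "frechet_derivative Z (at q)"
  have "poisson (fibre_linear Y) (fibre_linear Z) (q, p)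
     = (\<Sum>i\<in>UNIV. p \<bullet> (Y q $ i *\<^sub>R ?DZ (axis i 1)) - p \<bullet> (Z q $ i *\<^sub>R ?DY (axis i 1)))"
    unfolding poisson_def fibre_deriv_def base_deriv_def
    by (simp add: frechet_derivative_fibre_linear assms linear_frechet_derivative linear_0
        inner_axis' mult.commute)
  also have "\<dots> = p \<bullet> (\<Sum>i\<in>UNIV. Y q $ i *\<^sub>R ?DZ (axis i 1))
      - p \<bullet> (\<Sum>i\<in>UNIV. Z q $ i *\<^sub>R ?DY (axis i 1))"
    by (simp only: sum_subtractf inner_sum_right)
  also have "\<dots> = p \<bullet> ?DZ (Y q) - p \<bullet> ?DY (Z q)"
    by (simp add: linear_axis_expansion linear_frechet_derivative assms del: inner_scaleR_right)
  finally show "poisson (fibre_linear Y) (fibre_linear Z) (q, p) = fibre_linear (vf_bracket Y Z) (q, p)"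
    by (simp add: fibre_linear_def vf_bracket_def inner_diff_right)
qed

lemma poisson_fibre_linear_pullback:
  fixes a :: "real^3 \<Rightarrow> real"
  assumes "\<And>q. Y differentiable (at q)" "\<And>q. a differentiable (at q)"
  shows "poisson (fibre_linear Y) (a \<circ> fst) = (\<lambda>q. frechet_derivative a (at q) (Y q)) \<circ> fst"
proof (rule ext, safe)
  fix q p :: "real^3"
  let ?Da = "frechet_derivative a (at q)"
  have "poisson (fibre_linear Y) (a \<circ> fst) (q, p) = (\<Sum>i\<in>UNIV. Y q $ i *\<^sub>R ?Da (axis i 1))"
    unfolding poisson_def fibre_deriv_def base_deriv_def
    by (simp add: frechet_derivative_fibre_linear frechet_derivative_pullback assms
        linear_frechet_derivative linear_0 inner_axis')
  also have "\<dots> = ?Da (Y q)"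
    by (rule linear_axis_expansion) (simp add: linear_frechet_derivative assms)
  finally show "poisson (fibre_linear Y) (a \<circ> fst) (q, p) =
      ((\<lambda>q. frechet_derivative a (at q) (Y q)) \<circ> fst) (q, p)"
    by simp
qed


section \<open>The Heisenberg group and its conformal vector fields\<close>

text \<open>Coordinates: \<open>x = q $ 1\<close>, \<open>y = q $ 2\<close>, \<open>z = q $ 3\<close>.\<close>

definition heis_f1 :: vector_field
  where "heis_f1 = (\<lambda>q. vector [0, 1, q $ 1 / 2])"

definition heis_f2 :: vector_field
  where "heis_f2 = (\<lambda>q. vector [1, 0, - (q $ 2 / 2)])"

definition heis_hamiltonian :: "cotangent \<Rightarrow> real"
  where "heis_hamiltonian =
    (\<lambda>l. ((fibre_linear heis_f1 l)\<^sup>2 + (fibre_linear heis_f2 l)\<^sup>2) / 2)"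

definition conf_heis :: "vector_field set"
  where "conf_heis = {X. smooth X \<and>
    (\<exists>\<eta> :: real^3 \<Rightarrow> real. smooth \<eta> \<and>
      poisson (fibre_linear X) heis_hamiltonian = (\<lambda>l. 2 * \<eta> (fst l) * heis_hamiltonian l))}"


section \<open>The Lie algebra of SU(2,1)\<close>

definition ctranspose :: "complex^'n^'m \<Rightarrow> complex^'m^'n"
  where "ctranspose A = (\<chi> i j. cnj (A $ j $ i))"

definition form21 :: "complex^3^3"
  where "form21 = (\<chi> i j. if i \<noteq> j then 0 else if i = 3 then - 1 else 1)"

definition SU21 :: "(complex^3^3) set"
  where "SU21 = {g. ctranspose g ** form21 ** g = form21 \<and> det g = 1}"

text \<open>The Lie algebra of a matrix Lie group is its tangent space at the identity, i.e. the
  set of initial velocities of smooth curves in the group that start at the identity,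
  with the commutator as bracket.\<close>

definition tangent_at_one :: "(complex^'n^'n) set \<Rightarrow> (complex^'n^'n) set"
  where "tangent_at_one G = {A. \<exists>\<gamma> :: real \<Rightarrow> complex^'n^'n.
    smooth \<gamma> \<and> (\<forall>t. \<gamma> t \<in> G) \<and> \<gamma> 0 = mat 1 \<and> (\<gamma> has_vector_derivative A) (at 0)}"

definition commutator :: "complex^'n^'n \<Rightarrow> complex^'n^'n \<Rightarrow> complex^'n^'n"
  where "commutator A B = A ** B - B ** A"

definition su21 :: "(complex^3^3) set"
  where "su21 = tangent_at_one SU21"

end

theory Submission
  imports Defs
begin

text \<open>Write \<open>f\<^sub>0 = \<partial>\<^sub>z\<close>, so that \<open>[f\<^sub>1, f\<^sub>2] = - f\<^sub>0\<close> and \<open>f\<^sub>0\<close> is central. Since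
  \<open>{X\<^sup>*, h} = h\<^sub>1 [X, f\<^sub>1]\<^sup>* + h\<^sub>2 [X, f\<^sub>2]\<^sup>*\<close> is a quadratic form in the covector, comparing its
  coefficients with those of \<open>2 \<eta> h\<close> shows that a conformal field is determined by one function,
  its contact potential \<open>g = \<alpha>(X)\<close> with \<open>\<alpha> = dz + (y dx - x dy) / 2\<close>, and that \<open>g\<close> is the
  potential of a conformal field exactly when \<open>f\<^sub>1 f\<^sub>1 g = f\<^sub>2 f\<^sub>2 g\<close> and
  \<open>f\<^sub>1 f\<^sub>2 g = - f\<^sub>2 f\<^sub>1 g\<close> (\<open>conf_heis_eq_contact_fields\<close>).

  This system is of finite type. The commutation relations turn it into a closed first-order
  system for the eight functions
  \<open>g, f\<^sub>1 g, f\<^sub>2 g, f\<^sub>0 g, f\<^sub>1 f\<^sub>1 g, f\<^sub>0 f\<^sub>1 g, f\<^sub>0 f\<^sub>2 g, f\<^sub>0 f\<^sub>0 g\<close>: the horizontal derivatives of each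
  are combinations of those that follow it in this list, with coefficients \<open>0\<close> for the last. A
  function whose two horizontal derivatives vanish is constant, so integrating step by step from
  the end of the list gives one constant per function, and the solutions form an explicit eight-parameter
  family of polynomials (\<open>conformal_potential_imp_potential\<close>).

  On the other side, \<open>su(2,1)\<close> consists of the traceless matrices that are skew for the Hermitian
  form (\<open>su21_eq\<close>): differentiating a curve in the group gives one inclusion, and the other holds
  because tangent vectors can be added and rescaled and because explicit one-parameter groups
  reach enough directions.

  The isomorphism is geometric. With \<open>\<zeta> = x + i y\<close> and \<open>w = - |\<zeta>|\<^sup>2 - 4 i z\<close>, the map
  \<open>q \<mapsto> (1 + w, 2 \<zeta>, 1 - w)\<close> parametrises by the Heisenberg group the projective quadric of null
  vectors of the form, minus one point, so a matrix acting on null lines induces a vector field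
  on the Heisenberg group (\<open>projective_field\<close>). This assignment is linear, it is a Lie algebra
  homomorphism because it is the infinitesimal action of a group (\<open>projective_field_bracket\<close>),
  it is injective, and comparison of coefficients with the eight-parameter family shows that its
  image is the whole algebra of conformal fields (\<open>projective_field_image\<close>).\<close>

section \<open>Smooth maps\<close>

definition dir_deriv :: "'a::euclidean_space \<Rightarrow> ('a \<Rightarrow> 'b::real_normed_vector) \<Rightarrow> 'a \<Rightarrow> 'b"
  where "dir_deriv v f = (\<lambda>x. frechet_derivative f (at x) v)"

lemma dir_deriv_eqI:
  assumes "\<And>x. (f has_derivative f' x) (at x)"
  shows "dir_deriv v f = (\<lambda>x. f' x v)"
  unfolding dir_deriv_def using frechet_derivative_at[OF assms] by metis

lemma C_k_SucI:
  assumes "\<And>x. (f has_derivative f' x) (at x)" "\<And>v. C_k n (\<lambda>x. f' x v)"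
  shows "C_k (Suc n) f"
  using assms dir_deriv_eqI[OF assms(1)] unfolding dir_deriv_def
  by (auto simp: differentiable_def)

lemma C_k_Suc_imp: "C_k (Suc n) f \<Longrightarrow> C_k n f"
proof (induction n arbitrary: f)
  case 0
  then show ?case
    by (auto simp: continuous_on_eq_continuous_at differentiable_imp_continuous_within)
next
  case (Suc n)
  have "C_k (Suc n) (\<lambda>x. frechet_derivative f (at x) v)" for v
    using Suc.prems by auto
  then show ?case using Suc.IH Suc.prems by simp
qed

lemma C_k_const: "C_k n (\<lambda>x. c)"
  by (induction n arbitrary: c) auto

lemma C_k_add:
  fixes f g :: "'a::euclidean_space \<Rightarrow> 'b::real_normed_vector"
  shows "C_k n f \<Longrightarrow> C_k n g \<Longrightarrow> C_k n (\<lambda>x. f x + g x)"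
proof (induction n arbitrary: f g)
  case 0
  then show ?case by (auto intro: continuous_intros)
next
  case (Suc n)
  then have "(f has_derivative frechet_derivative f (at x)) (at x)"
    "(g has_derivative frechet_derivative g (at x)) (at x)" for x
    by (simp_all add: frechet_derivative_works)
  then have d: "((\<lambda>x. f x + g x) has_derivative
      (\<lambda>v. frechet_derivative f (at x) v + frechet_derivative g (at x) v)) (at x)" for x
    by (intro has_derivative_add)
  show ?case
    by (rule C_k_SucI[OF d]) (use Suc in simp)
qed

text \<open>Instantiated with the multiplication this is closure under products. In the
  Leibniz rule each derivative is paired with an undifferentiated factor, which is why the
  induction step uses \<open>C_k_Suc_imp\<close>.\<close>

lemma C_k_bilinear:
  fixes f :: "'a::euclidean_space \<Rightarrow> 'b::real_normed_vector"
    and g :: "'a \<Rightarrow> 'c::real_normed_vector"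
  assumes "bounded_bilinear p"
  shows "C_k n f \<Longrightarrow> C_k n g \<Longrightarrow> C_k n (\<lambda>x. p (f x) (g x))"
proof (induction n arbitrary: f g)
  case 0
  then show ?case
    by (simp add: bounded_bilinear.continuous_on[OF assms])
next
  case (Suc n)
  then have "(f has_derivative frechet_derivative f (at x)) (at x)"
    "(g has_derivative frechet_derivative g (at x)) (at x)" for x
    by (simp_all add: frechet_derivative_works)
  then have d: "((\<lambda>x. p (f x) (g x)) has_derivative
      (\<lambda>v. p (f x) (frechet_derivative g (at x) v) + p (frechet_derivative f (at x) v) (g x)))
      (at x)" for x
    by (intro bounded_bilinear.FDERIV[OF assms])
  have "C_k n f" "C_k n g" using Suc.prems C_k_Suc_imp by blast+
  moreover have "C_k n (\<lambda>x. frechet_derivative f (at x) v)"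
    "C_k n (\<lambda>x. frechet_derivative g (at x) v)" for v
    using Suc.prems by auto
  ultimately have "C_k n (\<lambda>x. p (f x) (frechet_derivative g (at x) v)
      + p (frechet_derivative f (at x) v) (g x))" for v
    by (intro C_k_add Suc.IH)
  then show ?case
    by (rule C_k_SucI[OF d])
qed

lemma C_k_linear:
  fixes f :: "'a::euclidean_space \<Rightarrow> 'b::real_normed_vector"
  assumes "bounded_linear L"
  shows "C_k n f \<Longrightarrow> C_k n (\<lambda>x. L (f x))"
proof (induction n arbitrary: f)
  case 0
  then show ?case by (simp add: bounded_linear.continuous_on[OF assms])
next
  case (Suc n)
  then have "(f has_derivative frechet_derivative f (at x)) (at x)" for x
    by (simp add: frechet_derivative_works)
  then have d: "((\<lambda>x. L (f x)) has_derivative (\<lambda>v. L (frechet_derivative f (at x) v))) (at x)" for x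
    by (rule bounded_linear.has_derivative[OF assms])
  show ?case
    by (rule C_k_SucI[OF d]) (use Suc in simp)
qed

lemma C_k_id: "C_k n (\<lambda>x::'a::euclidean_space. x)"
proof (cases n)
  case (Suc m)
  have "frechet_derivative (\<lambda>x::'a. x) (at x) v = v" for x v
    using frechet_derivative_at[OF has_derivative_ident] by metis
  then show ?thesis using Suc by (simp add: C_k_const)
qed simp

lemma smooth_const [intro]: "smooth (\<lambda>x. c)"
  by (simp add: smooth_def C_k_const)

lemma smooth_add [intro]: "smooth f \<Longrightarrow> smooth g \<Longrightarrow> smooth (\<lambda>x. f x + g x)"
  by (simp add: smooth_def C_k_add)

lemma smooth_mult [intro]:
  fixes f g :: "'a::euclidean_space \<Rightarrow> 'b::real_normed_algebra"
  shows "smooth f \<Longrightarrow> smooth g \<Longrightarrow> smooth (\<lambda>x. f x * g x)"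
  by (simp add: smooth_def C_k_bilinear[OF bounded_bilinear_mult])

lemma smooth_linear: "bounded_linear L \<Longrightarrow> smooth f \<Longrightarrow> smooth (\<lambda>x. L (f x))"
  by (simp add: smooth_def C_k_linear)

lemma smooth_minus [intro]: "smooth f \<Longrightarrow> smooth (\<lambda>x. - f x)"
  using smooth_linear[OF bounded_linear_minus[OF bounded_linear_ident]] .

lemma smooth_diff [intro]: "smooth f \<Longrightarrow> smooth g \<Longrightarrow> smooth (\<lambda>x. f x - g x)"
  using smooth_add[OF _ smooth_minus, of f g] by simp

lemma smooth_divide [intro]:
  fixes f :: "'a::euclidean_space \<Rightarrow> 'b::real_normed_field"
  shows "smooth f \<Longrightarrow> smooth (\<lambda>x. f x / c)"
  using smooth_mult[OF _ smooth_const, of f "inverse c"] by (simp add: divide_inverse)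

lemma smooth_power [intro]:
  fixes f :: "'a::euclidean_space \<Rightarrow> 'b::real_normed_field"
  shows "smooth f \<Longrightarrow> smooth (\<lambda>x. f x ^ n)"
  by (induction n) auto

lemma smooth_vec_nth [intro]: "smooth f \<Longrightarrow> smooth (\<lambda>x. f x $ i)"
  using smooth_linear[OF bounded_linear_vec_nth] .

lemma smooth_id [intro]: "smooth (\<lambda>x. x)"
  by (simp add: smooth_def C_k_id)

lemma smooth_sum [intro]: "(\<And>i. i \<in> I \<Longrightarrow> smooth (f i)) \<Longrightarrow> smooth (\<lambda>x. \<Sum>i\<in>I. f i x)"
  by (induction I rule: infinite_finite_induct) auto

lemma bounded_linear_axis: "bounded_linear (axis i :: 'b::real_normed_vector \<Rightarrow> 'b^'n)"
proof (rule bounded_linear_intro[where K = 1])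
  show "axis i (x + y) = axis i x + axis i y" for x y :: 'b
    by (simp add: vec_eq_iff axis_def)
  show "axis i (r *\<^sub>R x) = r *\<^sub>R axis i x" for r and x :: 'b
    by (simp add: vec_eq_iff axis_def)
  show "norm (axis i x :: 'b^'n) \<le> norm x * 1" for x :: 'b
  proof -
    have "norm (axis i x :: 'b^'n) \<le> (\<Sum>j\<in>UNIV. norm ((axis i x :: 'b^'n) $ j))"
      unfolding norm_vec_def by (rule L2_set_le_sum) simp
    also have "\<dots> = (\<Sum>j\<in>UNIV. if j = i then norm x else 0)"
      by (intro sum.cong) (auto simp: axis_def)
    finally show ?thesis by simp
  qed
qed

lemma sum_axis_vec_nth: "(\<Sum>i\<in>UNIV. axis i (x $ i)) = (x :: 'b::real_normed_vector^'n)"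
  by (simp add: vec_eq_iff axis_def sum_component)

text \<open>A vector-valued map is the sum of its components pushed along the coordinate axes, and these
  pushes are bounded linear.\<close>

lemma smooth_vec:
  fixes f :: "'a::euclidean_space \<Rightarrow> 'b::real_normed_vector^'n"
  assumes "\<And>i. smooth (\<lambda>x. f x $ i)"
  shows "smooth f"
proof -
  have "smooth (\<lambda>x. \<Sum>i\<in>UNIV. axis i (f x $ i))"
    using assms by (intro smooth_sum smooth_linear[OF bounded_linear_axis])
  then show ?thesis by (simp add: sum_axis_vec_nth)
qed

lemma smooth_dir_deriv [intro]: "smooth f \<Longrightarrow> smooth (dir_deriv v f)"
  unfolding smooth_def dir_deriv_def using C_k.simps(2) by blast

lemma smooth_has_derivative:
  assumes "smooth f"
  shows "(f has_derivative (\<lambda>v. dir_deriv v f x)) (at x)"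
proof -
  have "C_k (Suc 0) f" using assms by (simp only: smooth_def)
  then show ?thesis by (simp add: frechet_derivative_works dir_deriv_def)
qed

lemma smooth_differentiable: "smooth f \<Longrightarrow> f differentiable (at x)"
  using smooth_has_derivative differentiable_def by blast

lemma smooth_isCont: "smooth f \<Longrightarrow> isCont f x"
  using has_derivative_continuous smooth_has_derivative by blast

lemma C_k_scale_argument:
  assumes "C_k n f" shows "C_k n (\<lambda>t::real. f (c * t :: real))"
  using assms
proof (induction n arbitrary: f)
  case 0
  have "continuous_on UNIV (\<lambda>t. f (c * t))"
    by (rule continuous_on_compose2[of UNIV f]) (use 0 in \<open>auto intro: continuous_intros\<close>)
  then show ?case by simp
next
  case (Suc n)
  then have "(f has_derivative frechet_derivative f (at x)) (at x)" for x
    by (simp add: frechet_derivative_works)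
  then have d: "((\<lambda>t. f (c * t)) has_derivative (\<lambda>v. frechet_derivative f (at (c * t)) (c * v))) (at t)" for t
    by (rule has_derivative_compose[rotated]) (auto intro!: derivative_eq_intros)
  have "C_k n (\<lambda>t. frechet_derivative f (at (c * t)) (c * v))" for v
    using Suc.prems by (intro Suc.IH) auto
  then show ?case
    by (rule C_k_SucI[OF d])
qed

text \<open>The statement is proved for all multiples of the exponential at once, because a derivative
  of \<open>k * exp (c * t)\<close> is again such a multiple, with another \<open>k\<close>.\<close>

lemma smooth_exp: "smooth (\<lambda>t::real. exp (c * of_real t :: complex))"
proof -
  have "C_k n (\<lambda>t::real. k * exp (c * of_real t :: complex))" for n k
  proof (induction n arbitrary: k)
    case 0
    show ?case by (auto intro!: continuous_intros)
  next
    case (Suc n)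
    have e: "((\<lambda>t::real. exp (c * of_real t)) has_derivative
        (\<lambda>v. exp (c * of_real t) * (c * of_real v))) (at t)" for t
      by (rule has_derivative_compose[OF _ DERIV_exp[unfolded has_field_derivative_def]])
        (auto intro!: derivative_eq_intros)
    have d: "((\<lambda>t::real. k * exp (c * of_real t)) has_derivative
        (\<lambda>v. (k * c * of_real v) * exp (c * of_real t))) (at t)" for t
      by (rule has_derivative_eq_rhs[OF has_derivative_mult_right[OF e]]) (simp add: mult_ac)
    have "C_k n (\<lambda>t. (k * c * of_real v) * exp (c * of_real t))" for v
      by (rule Suc)
    then show ?case
      by (rule C_k_SucI[OF d])
  qed
  from this[of _ 1] show ?thesis by (simp add: smooth_def)
qed

text \<open>Two applications of the mean value theorem, first along \<open>u\<close> to the increment of \<open>f\<close> in the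
  direction \<open>v\<close>, then along \<open>v\<close>. Exchanging \<open>u\<close> and \<open>v\<close> leaves the
  second difference unchanged but swaps the order of the derivatives.\<close>

lemma second_difference:
  fixes f :: "'a::euclidean_space \<Rightarrow> real"
  assumes f: "smooth f" and s: "s > 0"
  shows "\<exists>\<xi> \<eta>. 0 < \<xi> \<and> \<xi> < s \<and> 0 < \<eta> \<and> \<eta> < s \<and>
    f (x + s *\<^sub>R u + s *\<^sub>R v) - f (x + s *\<^sub>R u) - f (x + s *\<^sub>R v) + f x
      = s\<^sup>2 * dir_deriv v (dir_deriv u f) (x + \<xi> *\<^sub>R u + \<eta> *\<^sub>R v)"
proof -
  have line: "((\<lambda>t. g (y + t *\<^sub>R w)) has_real_derivative dir_deriv w g (y + t *\<^sub>R w)) (at t)"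
    if "smooth g" for g :: "'a \<Rightarrow> real" and y w t
  proof -
    have "((\<lambda>t. g (y + t *\<^sub>R w)) has_derivative (\<lambda>r. dir_deriv (r *\<^sub>R w) g (y + t *\<^sub>R w))) (at t)"
      by (rule has_derivative_compose[OF _ smooth_has_derivative[OF that]])
        (auto intro!: derivative_eq_intros)
    moreover have "dir_deriv (r *\<^sub>R w) g y = r * dir_deriv w g y" for r y
      using linear_cmul[OF has_derivative_linear[OF smooth_has_derivative[OF that]]] by simp
    ultimately show ?thesis
      by (simp add: has_field_derivative_def mult_commute_abs)
  qed
  have "((\<lambda>t. f (x + s *\<^sub>R v + t *\<^sub>R u) - f (x + t *\<^sub>R u)) has_real_derivative
      dir_deriv u f (x + s *\<^sub>R v + t *\<^sub>R u) - dir_deriv u f (x + t *\<^sub>R u)) (at t)" for t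
    by (intro DERIV_diff line f)
  from MVT2[OF s this] obtain \<xi> where \<xi>: "0 < \<xi>" "\<xi> < s"
    "(f (x + s *\<^sub>R v + s *\<^sub>R u) - f (x + s *\<^sub>R u)) - (f (x + s *\<^sub>R v + 0 *\<^sub>R u) - f (x + 0 *\<^sub>R u))
      = (s - 0) * (dir_deriv u f (x + s *\<^sub>R v + \<xi> *\<^sub>R u) - dir_deriv u f (x + \<xi> *\<^sub>R u))"
    by blast
  from MVT2[OF s line[OF smooth_dir_deriv[OF f]]] obtain \<eta> where \<eta>: "0 < \<eta>" "\<eta> < s"
    "dir_deriv u f (x + \<xi> *\<^sub>R u + s *\<^sub>R v) - dir_deriv u f (x + \<xi> *\<^sub>R u + 0 *\<^sub>R v)
      = (s - 0) * dir_deriv v (dir_deriv u f) (x + \<xi> *\<^sub>R u + \<eta> *\<^sub>R v)"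
    by blast
  show ?thesis
  proof (rule exI[of _ \<xi>], rule exI[of _ \<eta>], intro conjI)
    have e: "x + s *\<^sub>R v + s *\<^sub>R u = x + s *\<^sub>R u + s *\<^sub>R v"
      "x + s *\<^sub>R v + \<xi> *\<^sub>R u = x + \<xi> *\<^sub>R u + s *\<^sub>R v"
      by simp_all
    show "f (x + s *\<^sub>R u + s *\<^sub>R v) - f (x + s *\<^sub>R u) - f (x + s *\<^sub>R v) + f x
      = s\<^sup>2 * dir_deriv v (dir_deriv u f) (x + \<xi> *\<^sub>R u + \<eta> *\<^sub>R v)"
      using \<xi>(3) \<eta>(3) unfolding e by (simp add: power2_eq_square mult.assoc)
  qed (use \<xi> \<eta> in auto)
qed

text \<open>Both mixed derivatives are limits of the same second difference quotient. This symmetry is the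
  source of every commutation relation between vector fields used below.\<close>

lemma dir_deriv_commute:
  fixes f :: "'a::euclidean_space \<Rightarrow> real"
  assumes f: "smooth f"
  shows "dir_deriv u (dir_deriv v f) = dir_deriv v (dir_deriv u f)"
proof
  fix x
  let ?F = "dir_deriv v (dir_deriv u f)" and ?G = "dir_deriv u (dir_deriv v f)"
  define s where "s n = 1 / real (Suc n)" for n
  have s: "s n > 0" for n by (simp add: s_def)
  have s0: "s \<longlonglongrightarrow> 0" unfolding s_def by (rule LIMSEQ_Suc[OF lim_1_over_n])
  have "\<exists>a b c d. 0 < a \<and> a < s n \<and> 0 < b \<and> b < s n \<and> 0 < c \<and> c < s n \<and> 0 < d \<and> d < s n
      \<and> ?F (x + a *\<^sub>R u + b *\<^sub>R v) = ?G (x + c *\<^sub>R v + d *\<^sub>R u)" for n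
  proof -
    from second_difference[OF f s, of n x u v] obtain a b where
      ab: "0 < a" "a < s n" "0 < b" "b < s n"
      "f (x + s n *\<^sub>R u + s n *\<^sub>R v) - f (x + s n *\<^sub>R u) - f (x + s n *\<^sub>R v) + f x
        = (s n)\<^sup>2 * ?F (x + a *\<^sub>R u + b *\<^sub>R v)" by blast
    from second_difference[OF f s, of n x v u] obtain c d where
      cd: "0 < c" "c < s n" "0 < d" "d < s n"
      "f (x + s n *\<^sub>R v + s n *\<^sub>R u) - f (x + s n *\<^sub>R v) - f (x + s n *\<^sub>R u) + f x
        = (s n)\<^sup>2 * ?G (x + c *\<^sub>R v + d *\<^sub>R u)" by blast
    have e: "x + s n *\<^sub>R v + s n *\<^sub>R u = x + s n *\<^sub>R u + s n *\<^sub>R v" by simp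
    have "(s n)\<^sup>2 * ?F (x + a *\<^sub>R u + b *\<^sub>R v) = (s n)\<^sup>2 * ?G (x + c *\<^sub>R v + d *\<^sub>R u)"
      using ab(5) cd(5)[unfolded e] by linarith
    then have "?F (x + a *\<^sub>R u + b *\<^sub>R v) = ?G (x + c *\<^sub>R v + d *\<^sub>R u)"
      using s[of n] by simp
    then show ?thesis using ab(1-4) cd(1-4) by blast
  qed
  then obtain a b c d where h: "\<And>n. 0 < a n" "\<And>n. a n < s n" "\<And>n. 0 < b n" "\<And>n. b n < s n"
      "\<And>n. 0 < c n" "\<And>n. c n < s n" "\<And>n. 0 < d n" "\<And>n. d n < s n"
      "\<And>n. ?F (x + a n *\<^sub>R u + b n *\<^sub>R v) = ?G (x + c n *\<^sub>R v + d n *\<^sub>R u)"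
    by metis
  have lim: "r \<longlonglongrightarrow> 0" if "\<And>n. 0 < r n" "\<And>n. r n < s n" for r :: "nat \<Rightarrow> real"
    by (rule tendsto_sandwich[OF _ _ tendsto_const s0])
      (use that in \<open>auto intro!: always_eventually less_imp_le\<close>)
  have "(\<lambda>n. x + a n *\<^sub>R u + b n *\<^sub>R v) \<longlonglongrightarrow> x + 0 *\<^sub>R u + 0 *\<^sub>R v"
    by (intro tendsto_intros lim h)
  then have "(\<lambda>n. ?F (x + a n *\<^sub>R u + b n *\<^sub>R v)) \<longlonglongrightarrow> ?F x"
    using isCont_tendsto_compose[OF smooth_isCont[OF smooth_dir_deriv[OF smooth_dir_deriv[OF f]]]]
    by simp
  moreover have "(\<lambda>n. x + c n *\<^sub>R v + d n *\<^sub>R u) \<longlonglongrightarrow> x + 0 *\<^sub>R v + 0 *\<^sub>R u"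
    by (intro tendsto_intros lim h)
  then have "(\<lambda>n. ?G (x + c n *\<^sub>R v + d n *\<^sub>R u)) \<longlonglongrightarrow> ?G x"
    using isCont_tendsto_compose[OF smooth_isCont[OF smooth_dir_deriv[OF smooth_dir_deriv[OF f]]]]
    by simp
  ultimately show "?G x = ?F x" using h(9) LIMSEQ_unique by simp
qed

section \<open>The Lie algebra of SU(2,1)\<close>

lemma ctranspose_mult: "ctranspose (A ** B) = ctranspose B ** ctranspose A"
  by (simp add: ctranspose_def matrix_matrix_mult_def vec_eq_iff mult.commute)

lemma has_vector_derivative_componentwise:
  fixes f :: "real \<Rightarrow> 'b::real_normed_vector^'n"
  assumes "\<And>i. ((\<lambda>t. f t $ i) has_vector_derivative D $ i) F"
  shows "(f has_vector_derivative D) F"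
proof -
  have "((\<lambda>t. \<Sum>i\<in>UNIV. axis i (f t $ i)) has_vector_derivative (\<Sum>i\<in>UNIV. axis i (D $ i))) F"
    by (intro has_vector_derivative_sum bounded_linear.has_vector_derivative[OF bounded_linear_axis] assms)
  then show ?thesis by (simp add: sum_axis_vec_nth)
qed

lemma has_vector_derivative_nth:
  "(f has_vector_derivative D) F \<Longrightarrow> ((\<lambda>t. f t $ i) has_vector_derivative D $ i) F"
  by (rule bounded_linear.has_vector_derivative[OF bounded_linear_vec_nth])

text \<open>Rescale the time of the curve.\<close>

lemma tangent_at_one_scaleR:
  assumes "A \<in> tangent_at_one G" shows "c *\<^sub>R A \<in> tangent_at_one G"
proof -
  from assms obtain \<gamma> where \<gamma>: "smooth \<gamma>" "\<And>t. \<gamma> t \<in> G" "\<gamma> 0 = mat 1"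
    "(\<gamma> has_vector_derivative A) (at 0)" by (auto simp: tangent_at_one_def)
  have "((\<gamma> \<circ> (\<lambda>t. c * t)) has_vector_derivative c *\<^sub>R A) (at 0)"
    by (rule vector_diff_chain_at) (use \<gamma>(4) in \<open>auto intro!: derivative_eq_intros\<close>)
  moreover have "smooth (\<lambda>t. \<gamma> (c * t))"
    using \<gamma>(1) C_k_scale_argument by (auto simp: smooth_def)
  ultimately show ?thesis
    using \<gamma> unfolding tangent_at_one_def o_def by (intro CollectI exI[of _ "\<lambda>t. \<gamma> (c * t)"]) auto
qed

text \<open>Multiply the two curves pointwise: at the identity the product rule adds the velocities. With
  rescaling, this reduces membership of a matrix in the Lie algebra to finding curves for the
  summands of some decomposition, without the exponential of the matrix itself.\<close>

lemma tangent_at_one_add: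
  fixes A B :: "complex^'n^'n"
  assumes G: "\<And>g h. g \<in> G \<Longrightarrow> h \<in> G \<Longrightarrow> g ** h \<in> G"
    and AB: "A \<in> tangent_at_one G" "B \<in> tangent_at_one G"
  shows "A + B \<in> tangent_at_one G"
proof -
  from AB obtain \<gamma> \<delta> where \<gamma>: "smooth \<gamma>" "\<And>t. \<gamma> t \<in> G" "\<gamma> 0 = mat 1"
    "(\<gamma> has_vector_derivative A) (at 0)" and \<delta>: "smooth \<delta>" "\<And>t. \<delta> t \<in> G" "\<delta> 0 = mat 1"
    "(\<delta> has_vector_derivative B) (at 0)" by (auto simp: tangent_at_one_def)
  have "((\<lambda>t. \<gamma> t ** \<delta> t) has_vector_derivative A + B) (at 0)"
  proof (intro has_vector_derivative_componentwise)
    fix i j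
    have "((\<lambda>t. \<Sum>k\<in>UNIV. \<gamma> t $ i $ k * \<delta> t $ k $ j) has_vector_derivative
        (\<Sum>k\<in>UNIV. \<gamma> 0 $ i $ k * B $ k $ j + A $ i $ k * \<delta> 0 $ k $ j)) (at 0)"
      by (intro has_vector_derivative_sum has_vector_derivative_mult has_vector_derivative_nth \<gamma> \<delta>)
    moreover have "(\<Sum>k\<in>UNIV. \<gamma> 0 $ i $ k * B $ k $ j + A $ i $ k * \<delta> 0 $ k $ j)
        = (mat 1 ** B + A ** mat 1) $ i $ j"
      unfolding \<gamma>(3) \<delta>(3) by (simp add: matrix_matrix_mult_def sum.distrib del: matrix_mul_lid matrix_mul_rid)
    then have "(\<Sum>k\<in>UNIV. \<gamma> 0 $ i $ k * B $ k $ j + A $ i $ k * \<delta> 0 $ k $ j) = (A + B) $ i $ j"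
      by (simp add: add.commute)
    ultimately show "((\<lambda>t. (\<gamma> t ** \<delta> t) $ i $ j) has_vector_derivative (A + B) $ i $ j) (at 0)"
      by (simp add: matrix_matrix_mult_def)
  qed
  moreover have "smooth (\<lambda>t. \<gamma> t ** \<delta> t)"
    unfolding matrix_matrix_mult_def
    by (rule smooth_vec, rule smooth_vec) (auto intro!: smooth_sum smooth_mult smooth_vec_nth \<gamma> \<delta>)
  ultimately show ?thesis
    using G \<gamma> \<delta> unfolding tangent_at_one_def
    by (intro CollectI exI[of _ "\<lambda>t. \<gamma> t ** \<delta> t"]) auto
qed

lemma SU21_mult: "g \<in> SU21 \<Longrightarrow> h \<in> SU21 \<Longrightarrow> g ** h \<in> SU21"
proof -
  assume g: "g \<in> SU21" and h: "h \<in> SU21"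
  have "ctranspose (g ** h) ** form21 ** (g ** h)
      = ctranspose h ** (ctranspose g ** form21 ** g) ** h"
    by (simp add: ctranspose_mult matrix_mul_assoc)
  then show ?thesis using g h by (simp add: SU21_def det_mul)
qed

lemma SU21_iff: "g \<in> SU21 \<longleftrightarrow>
  (\<forall>i j. cnj (g$1$i) * g$1$j + cnj (g$2$i) * g$2$j - cnj (g$3$i) * g$3$j = form21 $ i $ j) \<and> det g = 1"
  by (simp add: SU21_def vec_eq_iff matrix_matrix_mult_def sum_3 ctranspose_def form21_def)

text \<open>The traceless matrices that are skew for the form: the diagonal is imaginary with sum \<open>0\<close>, and
  the entries below it are determined by those above. The signs differ because the third basis
  vector is negative for the form.\<close>

definition su21_matrix :: "real \<Rightarrow> real \<Rightarrow> complex \<Rightarrow> complex \<Rightarrow> complex \<Rightarrow> complex^3^3"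
  where "su21_matrix a b u v s =
    vector [vector [\<i> * a, u, v], vector [- cnj u, \<i> * b, s], vector [cnj v, cnj s, - (\<i> * (a + b))]]"

lemma smooth_of_real_cos: "smooth (\<lambda>t. complex_of_real (cos t))"
proof -
  have "smooth (\<lambda>t::real. (exp (\<i> * of_real t) + exp (- \<i> * of_real t)) / 2)"
    by (intro smooth_divide smooth_add smooth_exp)
  then show ?thesis by (simp add: cos_of_real[symmetric] cos_exp_eq)
qed

lemma smooth_of_real_sin: "smooth (\<lambda>t. complex_of_real (sin t))"
proof -
  have "smooth (\<lambda>t::real. (exp (\<i> * of_real t) - exp (- \<i> * of_real t)) / (2 * \<i>))"
    by (intro smooth_divide smooth_diff smooth_exp)
  then show ?thesis by (simp add: sin_of_real[symmetric] sin_exp_eq)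
qed

lemma smooth_of_real_cosh: "smooth (\<lambda>t. complex_of_real (cosh t))"
proof -
  have "smooth (\<lambda>t::real. (exp (1 * of_real t) + exp ((- 1) * of_real t) :: complex) / 2)"
    by (intro smooth_divide smooth_add smooth_exp)
  then show ?thesis by (simp add: cosh_field_def exp_of_real[symmetric])
qed

lemma smooth_of_real_sinh: "smooth (\<lambda>t. complex_of_real (sinh t))"
proof -
  have "smooth (\<lambda>t::real. (exp (1 * of_real t) - exp ((- 1) * of_real t) :: complex) / 2)"
    by (intro smooth_divide smooth_diff smooth_exp)
  then show ?thesis by (simp add: sinh_field_def exp_of_real[symmetric])
qed

lemma has_vector_derivative_of_real_at_0:
  "((\<lambda>t. complex_of_real (cos t)) has_vector_derivative 0) (at 0)"
  "((\<lambda>t. complex_of_real (sin t)) has_vector_derivative 1) (at 0)"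
  "((\<lambda>t. complex_of_real (cosh t)) has_vector_derivative 0) (at 0)"
  "((\<lambda>t. complex_of_real (sinh t)) has_vector_derivative 1) (at 0)"
proof -
  have "(cos has_field_derivative 0) (at (0::real))" "(sin has_field_derivative 1) (at (0::real))"
    "(cosh has_field_derivative 0) (at (0::real))" "(sinh has_field_derivative 1) (at (0::real))"
    by (auto intro!: derivative_eq_intros)
  from this[THEN has_vector_derivative_of_real]
  show "((\<lambda>t. complex_of_real (cos t)) has_vector_derivative 0) (at 0)"
    "((\<lambda>t. complex_of_real (sin t)) has_vector_derivative 1) (at 0)"
    "((\<lambda>t. complex_of_real (cosh t)) has_vector_derivative 0) (at 0)"
    "((\<lambda>t. complex_of_real (sinh t)) has_vector_derivative 1) (at 0)"
    by simp_all
qed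

lemmas generator_simps = vec_eq_iff forall_3 mat_def su21_matrix_def form21_def det_3

text \<open>The one-parameter groups below are written for off-diagonal entries of modulus one; up to
  rescaling, these are all the entries.\<close>

lemma unit_factor: obtains r :: real and e :: complex where "u = r *\<^sub>R e" "e * cnj e = 1"
proof (cases "u = 0")
  case True
  then show ?thesis using that[of 0 1] by simp
next
  case False
  have "norm (u /\<^sub>R norm u) = 1" using False by simp
  then have "(u /\<^sub>R norm u) * cnj (u /\<^sub>R norm u) = 1"
    by (metis complex_norm_square of_real_1 one_power2)
  then show ?thesis using that[of "norm u" "u /\<^sub>R norm u"] False by simp
qed

lemma su21_matrix_add:
  "su21_matrix a b u v s + su21_matrix a' b' u' v' s' = su21_matrix (a + a') (b + b') (u + u') (v + v') (s + s')"
  by (simp add: su21_matrix_def vec_eq_iff forall_3 algebra_simps)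

lemma su21_matrix_scaleR:
  "(c::real) *\<^sub>R su21_matrix a b u v s = su21_matrix (c * a) (c * b) (c *\<^sub>R u) (c *\<^sub>R v) (c *\<^sub>R s)"
  unfolding vec_eq_iff forall_3 vector_scaleR_component
  by (simp add: su21_matrix_def complex_eq_iff algebra_simps)

lemma smooth_matrix3:
  assumes "smooth a11" "smooth a12" "smooth a13" "smooth a21" "smooth a22" "smooth a23"
    "smooth a31" "smooth a32" "smooth a33"
  shows "smooth (\<lambda>t::real. vector [vector [a11 t, a12 t, a13 t], vector [a21 t, a22 t, a23 t],
    vector [a31 t, a32 t, a33 t]] :: complex^3^3)"
proof (intro smooth_vec)
  fix i j
  show "smooth (\<lambda>t. (vector [vector [a11 t, a12 t, a13 t], vector [a21 t, a22 t, a23 t],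
    vector [a31 t, a32 t, a33 t]] :: complex^3^3) $ i $ j)"
    using exhaust_3[of i] exhaust_3[of j] assms by auto
qed

lemma has_vector_derivative_matrix3:
  assumes "(a11 has_vector_derivative b11) F" "(a12 has_vector_derivative b12) F"
    "(a13 has_vector_derivative b13) F" "(a21 has_vector_derivative b21) F"
    "(a22 has_vector_derivative b22) F" "(a23 has_vector_derivative b23) F"
    "(a31 has_vector_derivative b31) F" "(a32 has_vector_derivative b32) F"
    "(a33 has_vector_derivative b33) F"
  shows "((\<lambda>t::real. vector [vector [a11 t, a12 t, a13 t], vector [a21 t, a22 t, a23 t],
      vector [a31 t, a32 t, a33 t]] :: complex^3^3) has_vector_derivative
    vector [vector [b11, b12, b13], vector [b21, b22, b23], vector [b31, b32, b33]]) F"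
    (is "(?g has_vector_derivative ?D) F")
proof (intro has_vector_derivative_componentwise)
  fix i j
  show "((\<lambda>t. ?g t $ i $ j) has_vector_derivative ?D $ i $ j) F"
    using exhaust_3[of i] exhaust_3[of j] assms by auto
qed

lemma su21_intro:
  assumes "smooth \<gamma>" "(\<gamma> has_vector_derivative A) (at 0)" "\<gamma> 0 = mat 1" "\<And>t. \<gamma> t \<in> SU21"
  shows "A \<in> su21"
  using assms unfolding su21_def tangent_at_one_def by blast

lemma const_mult_deriv:
  assumes "(f has_vector_derivative 1) F"
  shows "((\<lambda>t. f t * (c::complex)) has_vector_derivative c) F"
  using has_vector_derivative_mult_left[OF assms, of c] by simp

text \<open>The first and second basis vectors have the same sign for the form, so the group in their plane
  consists of rotations; planes that contain the third basis vector give hyperbolic rotations.\<close>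

lemma rotation_generator:
  assumes "e * cnj e = 1" shows "su21_matrix 0 0 e 0 0 \<in> su21"
proof (rule su21_intro)
  let ?g = "\<lambda>t. vector [vector [of_real (cos t), of_real (sin t) * e, 0],
    vector [of_real (sin t) * (- cnj e), of_real (cos t), 0], vector [0, 0, 1]] :: complex^3^3"
  show "smooth ?g"
    by (intro smooth_matrix3 smooth_const smooth_mult smooth_of_real_cos smooth_of_real_sin)
  show "?g 0 = mat 1" by (simp add: generator_simps)
  show "(?g has_vector_derivative su21_matrix 0 0 e 0 0) (at 0)"
    unfolding su21_matrix_def
    by (rule has_vector_derivative_eq_rhs, rule has_vector_derivative_matrix3,
        (rule const_mult_deriv has_vector_derivative_const has_vector_derivative_of_real_at_0)+) simp
  fix t
  have "complex_of_real (cos t) * of_real (cos t) + of_real (sin t) * of_real (sin t) = 1"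
    by (metis of_real_1 of_real_add of_real_mult power2_eq_square sin_cos_squared_add2)
  then show "?g t \<in> SU21"
    using assms unfolding SU21_iff
    by (simp add: generator_simps; algebra)
qed

lemma cosh_sinh_complex: "complex_of_real (cosh t) * of_real (cosh t) - of_real (sinh t) * of_real (sinh t) = 1"
proof -
  have "(cosh t)\<^sup>2 - (sinh t)\<^sup>2 = 1" by (simp add: cosh_square_eq)
  then show ?thesis by (metis of_real_1 of_real_diff of_real_mult power2_eq_square)
qed

lemma boost13_generator:
  assumes "e * cnj e = 1" shows "su21_matrix 0 0 0 e 0 \<in> su21"
proof (rule su21_intro)
  let ?g = "\<lambda>t. vector [vector [of_real (cosh t), 0, of_real (sinh t) * e], vector [0, 1, 0],
    vector [of_real (sinh t) * cnj e, 0, of_real (cosh t)]] :: complex^3^3"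
  show "smooth ?g"
    by (intro smooth_matrix3 smooth_const smooth_mult smooth_of_real_cosh smooth_of_real_sinh)
  show "?g 0 = mat 1" by (simp add: generator_simps)
  show "(?g has_vector_derivative su21_matrix 0 0 0 e 0) (at 0)"
    unfolding su21_matrix_def
    by (rule has_vector_derivative_eq_rhs, rule has_vector_derivative_matrix3,
        (rule const_mult_deriv has_vector_derivative_const has_vector_derivative_of_real_at_0)+) simp
  show "?g t \<in> SU21" for t
    using assms cosh_sinh_complex[of t] unfolding SU21_iff
    by (simp add: generator_simps; algebra)
qed

lemma boost23_generator:
  assumes "e * cnj e = 1" shows "su21_matrix 0 0 0 0 e \<in> su21"
proof (rule su21_intro)
  let ?g = "\<lambda>t. vector [vector [1, 0, 0], vector [0, of_real (cosh t), of_real (sinh t) * e],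
    vector [0, of_real (sinh t) * cnj e, of_real (cosh t)]] :: complex^3^3"
  show "smooth ?g"
    by (intro smooth_matrix3 smooth_const smooth_mult smooth_of_real_cosh smooth_of_real_sinh)
  show "?g 0 = mat 1" by (simp add: generator_simps)
  show "(?g has_vector_derivative su21_matrix 0 0 0 0 e) (at 0)"
    unfolding su21_matrix_def
    by (rule has_vector_derivative_eq_rhs, rule has_vector_derivative_matrix3,
        (rule const_mult_deriv has_vector_derivative_const has_vector_derivative_of_real_at_0)+) simp
  show "?g t \<in> SU21" for t
    using assms cosh_sinh_complex[of t] unfolding SU21_iff
    by (simp add: generator_simps; algebra)
qed

lemma diagonal_generator: "su21_matrix a b 0 0 0 \<in> su21"
proof (rule su21_intro)
  let ?E = "\<lambda>(c::real) (t::real). exp ((\<i> * of_real c) * of_real t)"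
  let ?g = "\<lambda>t. vector [vector [?E a t, 0, 0], vector [0, ?E b t, 0],
    vector [0, 0, ?E (- (a + b)) t]] :: complex^3^3"
  show "smooth ?g" by (intro smooth_matrix3 smooth_const smooth_exp)
  show "?g 0 = mat 1" by (simp add: generator_simps)
  have E: "(?E c has_vector_derivative \<i> * of_real c) (at 0)" for c
  proof -
    have "((\<lambda>z. exp ((\<i> * of_real c) * z)) has_field_derivative \<i> * of_real c) (at (of_real 0))"
      by (auto intro!: derivative_eq_intros)
    from has_vector_derivative_real_field[OF this] show ?thesis .
  qed
  show "(?g has_vector_derivative su21_matrix a b 0 0 0) (at 0)"
    unfolding su21_matrix_def
    by (rule has_vector_derivative_eq_rhs, rule has_vector_derivative_matrix3,
        (rule E has_vector_derivative_const)+) (simp add: algebra_simps)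
  fix t :: real
  have "cnj (?E c t) * ?E c t = 1" for c
    by (simp add: exp_cnj flip: exp_add)
  note this[of a] this[of b] this[of "- (a + b)"]
  moreover have "?E a t * ?E b t * ?E (- (a + b)) t = 1"
    by (simp add: algebra_simps flip: exp_add)
  ultimately show "?g t \<in> SU21"
    unfolding SU21_iff by (simp add: generator_simps)
qed

lemma su21_add: "A \<in> su21 \<Longrightarrow> B \<in> su21 \<Longrightarrow> A + B \<in> su21"
  unfolding su21_def by (rule tangent_at_one_add[OF SU21_mult])

lemma su21_scaleR: "A \<in> su21 \<Longrightarrow> c *\<^sub>R A \<in> su21"
  unfolding su21_def by (rule tangent_at_one_scaleR)

lemma su21_matrix_in_su21: "su21_matrix a b u v s \<in> su21"
proof -
  obtain ru eu where u: "u = ru *\<^sub>R eu" "eu * cnj eu = 1" by (rule unit_factor)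
  obtain rv ev where v: "v = rv *\<^sub>R ev" "ev * cnj ev = 1" by (rule unit_factor)
  obtain rs es where s: "s = rs *\<^sub>R es" "es * cnj es = 1" by (rule unit_factor)
  have "su21_matrix a b 0 0 0 + ru *\<^sub>R su21_matrix 0 0 eu 0 0 + rv *\<^sub>R su21_matrix 0 0 0 ev 0
      + rs *\<^sub>R su21_matrix 0 0 0 0 es \<in> su21"
    by (intro su21_add su21_scaleR diagonal_generator rotation_generator boost13_generator
        boost23_generator u v s)
  then show ?thesis by (simp add: su21_matrix_add su21_matrix_scaleR u v s)
qed

text \<open>Differentiate the equations \<open>g\<^sup>* J g = J\<close> and \<open>det g = 1\<close> along a curve through the identity,
  entry by entry.\<close>

lemma su21_skew:
  assumes "A \<in> su21"
  shows "ctranspose A ** form21 + form21 ** A = 0" "trace A = 0"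
proof -
  obtain \<gamma> where \<gamma>: "\<And>t. \<gamma> t \<in> SU21" "\<gamma> 0 = mat 1" "(\<gamma> has_vector_derivative A) (at 0)"
    using assms unfolding su21_def tangent_at_one_def by blast
  note d = has_vector_derivative_nth[OF has_vector_derivative_nth[OF \<gamma>(3)]]
  note dc = bounded_linear.has_vector_derivative[OF bounded_linear_cnj d]
  have const: "D = 0" if "(f has_vector_derivative D) (at 0)" "\<And>t. f t = c"
    for f :: "real \<Rightarrow> complex" and D c
  proof -
    have "f = (\<lambda>t. c)" using that(2) by blast
    then show ?thesis
      using vector_derivative_unique_at[OF that(1)] by simp
  qed
  show "ctranspose A ** form21 + form21 ** A = 0"
  proof (simp only: vec_eq_iff, intro allI)
    fix i j
    have "((\<lambda>t. cnj (\<gamma> t $1$i) * \<gamma> t $1$j + cnj (\<gamma> t $2$i) * \<gamma> t $2$j - cnj (\<gamma> t $3$i) * \<gamma> t $3$j)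
      has_vector_derivative
        (cnj (\<gamma> 0 $1$i) * A$1$j + cnj (A$1$i) * \<gamma> 0 $1$j + (cnj (\<gamma> 0 $2$i) * A$2$j + cnj (A$2$i) * \<gamma> 0 $2$j)
        - (cnj (\<gamma> 0 $3$i) * A$3$j + cnj (A$3$i) * \<gamma> 0 $3$j))) (at 0)"
      by (intro has_vector_derivative_add has_vector_derivative_diff has_vector_derivative_mult d dc)
    from const[OF this, of "form21 $ i $ j"] \<gamma>(1)
    have "cnj (\<gamma> 0 $1$i) * A$1$j + cnj (A$1$i) * \<gamma> 0 $1$j + (cnj (\<gamma> 0 $2$i) * A$2$j + cnj (A$2$i) * \<gamma> 0 $2$j)
        - (cnj (\<gamma> 0 $3$i) * A$3$j + cnj (A$3$i) * \<gamma> 0 $3$j) = 0"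
      by (simp add: SU21_iff)
    moreover have "(ctranspose A ** form21 + form21 ** A) $ i $ j
        = cnj (\<gamma> 0 $1$i) * A$1$j + cnj (A$1$i) * \<gamma> 0 $1$j + (cnj (\<gamma> 0 $2$i) * A$2$j + cnj (A$2$i) * \<gamma> 0 $2$j)
        - (cnj (\<gamma> 0 $3$i) * A$3$j + cnj (A$3$i) * \<gamma> 0 $3$j)"
      unfolding \<gamma>(2) using exhaust_3[of i] exhaust_3[of j]
      by (elim disjE; simp add: mat_def ctranspose_def form21_def matrix_matrix_mult_def sum_3)
    ultimately show "(ctranspose A ** form21 + form21 ** A) $ i $ j = 0 $ i $ j"
      by simp
  qed
  have p: "((\<lambda>t. \<gamma> t$1$i * \<gamma> t$2$j * \<gamma> t$3$k) has_vector_derivative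
      \<gamma> 0$1$i * \<gamma> 0$2$j * A$3$k + (\<gamma> 0$1$i * A$2$j + A$1$i * \<gamma> 0$2$j) * \<gamma> 0$3$k) (at 0)" for i j k
    by (intro has_vector_derivative_mult d)
  have det: "det g = g$1$1 * g$2$2 * g$3$3 + g$1$2 * g$2$3 * g$3$1 + g$1$3 * g$2$1 * g$3$2
      - g$1$1 * g$2$3 * g$3$2 - g$1$2 * g$2$1 * g$3$3 - g$1$3 * g$2$2 * g$3$1" for g :: "complex^3^3"
    by (simp add: det_3)
  have "((\<lambda>t. det (\<gamma> t)) has_vector_derivative trace A) (at 0)"
    unfolding det
    using has_vector_derivative_diff[OF has_vector_derivative_diff[OF has_vector_derivative_diff[OF
      has_vector_derivative_add[OF has_vector_derivative_add[OF p[of 1 2 3] p[of 2 3 1]] p[of 3 1 2]]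
      p[of 1 3 2]] p[of 2 1 3]] p[of 3 2 1]]
    by (simp add: \<gamma>(2) mat_def trace_def sum_3 add_ac)
  then show "trace A = 0"
    using const[of "\<lambda>t. det (\<gamma> t)" "trace A" 1] \<gamma>(1) by (simp add: SU21_def)
qed

lemma skew_imp_su21_matrix:
  assumes "ctranspose A ** form21 + form21 ** A = 0" "trace A = 0"
  shows "A = su21_matrix (Im (A$1$1)) (Im (A$2$2)) (A$1$2) (A$1$3) (A$2$3)"
proof -
  have e: "(ctranspose A ** form21 + form21 ** A) $ i $ j = 0" for i j by (simp add: assms)
  have "cnj (A$1$1) + A$1$1 = 0" "cnj (A$2$2) + A$2$2 = 0"
    "cnj (A$1$2) + A$2$1 = 0"
    "cnj (A$1$3) - A$3$1 = 0" "cnj (A$2$3) - A$3$2 = 0"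
    using e[of 1 1] e[of 2 2] e[of 2 1] e[of 3 1] e[of 3 2]
    by (simp_all add: ctranspose_def form21_def matrix_matrix_mult_def sum_3)
  then have o: "A$2$1 = - cnj (A$1$2)" "A$3$1 = cnj (A$1$3)" "A$3$2 = cnj (A$2$3)"
    and re: "Re (A$1$1) = 0" "Re (A$2$2) = 0"
    by (simp_all add: add_eq_0_iff complex_eq_iff)
  from re have d: "A$1$1 = \<i> * Im (A$1$1)" "A$2$2 = \<i> * Im (A$2$2)"
    by (simp_all add: complex_eq_iff)
  have "A$1$1 + A$2$2 + A$3$3 = 0"
    using assms(2) by (simp add: trace_def sum_3)
  then have "A$3$3 = - (A$1$1 + A$2$2)" by (simp only: eq_neg_iff_add_eq_0 add.commute)
  also have "\<dots> = - (\<i> * (Im (A$1$1) + Im (A$2$2)))"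
    using re by (simp add: complex_eq_iff)
  finally show ?thesis
    unfolding su21_matrix_def vec_eq_iff forall_3 vector_3 using o d by blast
qed

lemma su21_eq: "su21 = {A. ctranspose A ** form21 + form21 ** A = 0 \<and> trace A = 0}"
proof (intro equalityI subsetI)
  fix A assume "A \<in> {A. ctranspose A ** form21 + form21 ** A = 0 \<and> trace A = 0}"
  then show "A \<in> su21"
    using skew_imp_su21_matrix[of A]
      su21_matrix_in_su21[of "Im (A$1$1)" "Im (A$2$2)" "A$1$2" "A$1$3" "A$2$3"] by simp
qed (simp add: su21_skew)

lemma su21_cases:
  assumes "A \<in> su21" obtains a b u v s where "A = su21_matrix a b u v s"
  using su21_skew[OF assms] skew_imp_su21_matrix that by blast

text \<open>The algebra consists of the matrices with \<open>A\<^sup>* J = - J A\<close>, so the adjoint reverses a product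
  and the two signs cancel: \<open>(X Y)\<^sup>* J = J Y X\<close>.\<close>

lemma su21_commutator: assumes "A \<in> su21" "B \<in> su21" shows "commutator A B \<in> su21"
proof -
  have skew: "ctranspose X ** form21 = - (form21 ** X)" if "X \<in> su21" for X
    using su21_skew(1)[OF that] eq_neg_iff_add_eq_0 by blast
  have neg: "X ** (- Y) = - (X ** Y)" "(- X) ** Y = - (X ** Y)" for X Y :: "complex^3^3"
    by (simp_all add: matrix_matrix_mult_def vec_eq_iff sum_negf)
  have p: "ctranspose (X ** Y) ** form21 = form21 ** (Y ** X)" if "X \<in> su21" "Y \<in> su21" for X Y
  proof -
    have "ctranspose (X ** Y) ** form21 = ctranspose Y ** (ctranspose X ** form21)"
      by (simp add: ctranspose_mult matrix_mul_assoc)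
    also have "\<dots> = - ((ctranspose Y ** form21) ** X)"
      using skew[OF that(1)] by (simp add: neg matrix_mul_assoc)
    also have "\<dots> = form21 ** (Y ** X)"
      using skew[OF that(2)] by (simp add: neg matrix_mul_assoc)
    finally show ?thesis .
  qed
  have dist: "(X - Y) ** Z = X ** Z - Y ** Z" "Z ** (X - Y) = Z ** X - Z ** Y"
    "ctranspose (X - Y) = ctranspose X - ctranspose Y" for X Y Z :: "complex^3^3"
    by (simp_all add: matrix_matrix_mult_def vec_eq_iff sum_subtractf algebra_simps ctranspose_def)
  show ?thesis
    unfolding su21_eq commutator_def
    by (simp add: dist p assms trace_sub trace_mul_sym[of A B])
qed

lemma real_lie_algebra_su21: "real_lie_algebra su21 commutator"
proof -
  have "0 \<in> su21" using su21_scaleR[where c = 0, OF su21_matrix_in_su21] by simp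
  then have sub: "subspace su21"
    by (simp add: subspace_def su21_add su21_scaleR)
  have scale: "X ** (c *\<^sub>R Y) = c *\<^sub>R (X ** Y)" "(c *\<^sub>R X) ** Y = c *\<^sub>R (X ** Y)"
    for X Y :: "complex^3^3" and c
    by (simp_all add: matrix_matrix_mult_def vec_eq_iff scaleR_sum_right)
  have dist: "X ** (Y + Z) = X ** Y + X ** Z" "(X + Y) ** Z = X ** Z + Y ** Z"
    "(X - Y) ** Z = X ** Z - Y ** Z" "Z ** (X - Y) = Z ** X - Z ** Y" for X Y Z :: "complex^3^3"
    by (simp_all add: matrix_matrix_mult_def vec_eq_iff sum.distrib sum_subtractf algebra_simps)
  have jacobi: "commutator X (commutator Y Z) + commutator Y (commutator Z X)
      + commutator Z (commutator X Y) = 0" for X Y Z :: "complex^3^3"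
    by (simp add: commutator_def dist matrix_mul_assoc)
  show ?thesis
    unfolding real_lie_algebra_def
  proof (intro conjI ballI allI sub su21_commutator jacobi)
    fix X Y Z :: "complex^3^3" and c :: real
    show "commutator (X + Y) Z = commutator X Z + commutator Y Z"
      "commutator X (Y + Z) = commutator X Y + commutator X Z"
      "commutator (c *\<^sub>R X) Y = c *\<^sub>R commutator X Y"
      "commutator X (c *\<^sub>R Y) = c *\<^sub>R commutator X Y"
      "commutator X X = 0"
      by (simp_all add: commutator_def dist scale scaleR_diff_right)
  qed
qed

section \<open>Derivatives along vector fields\<close>

definition lie_deriv :: "vector_field \<Rightarrow> (real^3 \<Rightarrow> real) \<Rightarrow> real^3 \<Rightarrow> real"
  where "lie_deriv X g = (\<lambda>q. frechet_derivative g (at q) (X q))"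

lemma lie_deriv_eqI:
  assumes "\<And>q. (g has_derivative g' q) (at q)"
  shows "lie_deriv X g = (\<lambda>q. g' q (X q))"
  unfolding lie_deriv_def using frechet_derivative_at[OF assms] by metis

lemma smooth_frechet:
  "smooth f \<Longrightarrow> (f has_derivative frechet_derivative f (at q)) (at q)"
  using frechet_derivative_works smooth_differentiable by blast

lemma lie_deriv_const [simp]: "lie_deriv X (\<lambda>q. c) = (\<lambda>q. 0)"
  by (rule lie_deriv_eqI) (rule has_derivative_const)

lemma lie_deriv_coord [simp]: "lie_deriv X (\<lambda>q. q $ i) = (\<lambda>q. X q $ i)"
  by (rule lie_deriv_eqI) (rule bounded_linear_imp_has_derivative[OF bounded_linear_vec_nth])

lemma lie_deriv_add [simp]:
  assumes "smooth f" "smooth g"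
  shows "lie_deriv X (\<lambda>q. f q + g q) = (\<lambda>q. lie_deriv X f q + lie_deriv X g q)"
  using lie_deriv_eqI[OF has_derivative_add[OF smooth_frechet[OF assms(1)] smooth_frechet[OF assms(2)]]]
  by (simp add: lie_deriv_def)

lemma lie_deriv_diff [simp]:
  assumes "smooth f" "smooth g"
  shows "lie_deriv X (\<lambda>q. f q - g q) = (\<lambda>q. lie_deriv X f q - lie_deriv X g q)"
  using lie_deriv_eqI[OF has_derivative_diff[OF smooth_frechet[OF assms(1)] smooth_frechet[OF assms(2)]]]
  by (simp add: lie_deriv_def)

lemma lie_deriv_mult [simp]:
  assumes "smooth f" "smooth g"
  shows "lie_deriv X (\<lambda>q. f q * g q) = (\<lambda>q. lie_deriv X f q * g q + f q * lie_deriv X g q)"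
  using lie_deriv_eqI[OF has_derivative_mult[OF smooth_frechet[OF assms(1)] smooth_frechet[OF assms(2)]]]
  by (simp add: lie_deriv_def add.commute)

lemma lie_deriv_minus [simp]:
  assumes "smooth f"
  shows "lie_deriv X (\<lambda>q. - f q) = (\<lambda>q. - lie_deriv X f q)"
  using lie_deriv_eqI[OF has_derivative_minus[OF smooth_frechet[OF assms]]]
  by (simp add: lie_deriv_def)

lemma lie_deriv_divide [simp]:
  assumes "smooth f"
  shows "lie_deriv X (\<lambda>q. f q / c) = (\<lambda>q. lie_deriv X f q / c)"
  using lie_deriv_mult[OF assms smooth_const, of X "inverse c"] by (simp add: divide_inverse)

lemma lie_deriv_power2 [simp]:
  assumes "smooth f"
  shows "lie_deriv X (\<lambda>q. (f q)\<^sup>2) = (\<lambda>q. 2 * f q * lie_deriv X f q)"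
  using lie_deriv_mult[OF assms assms] by (simp add: power2_eq_square fun_eq_iff)

lemma lie_deriv_axis_expansion:
  assumes "smooth g"
  shows "lie_deriv X g q = (\<Sum>i\<in>UNIV. X q $ i * dir_deriv (axis i 1) g q)"
  using linear_axis_expansion[OF linear_frechet_derivative[OF smooth_differentiable[OF assms]], of "X q" q]
  by (simp add: lie_deriv_def dir_deriv_def)

lemma smooth_lie_deriv [intro]:
  assumes "smooth X" "smooth g" shows "smooth (lie_deriv X g)"
proof -
  have "smooth (\<lambda>q. \<Sum>i\<in>UNIV. X q $ i * dir_deriv (axis i 1) g q)"
    using assms by (intro smooth_sum smooth_mult smooth_vec_nth smooth_dir_deriv)
  then show ?thesis using lie_deriv_axis_expansion[OF assms(2), of X] by presburger
qed

lemma lie_deriv_vec_nth: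
  assumes "smooth Y"
  shows "lie_deriv X (\<lambda>q. Y q $ j) = (\<lambda>q. frechet_derivative Y (at q) (X q) $ j)"
  by (rule lie_deriv_eqI[OF bounded_linear.has_derivative[OF bounded_linear_vec_nth smooth_frechet[OF assms]]])

lemma vf_bracket_nth:
  assumes "smooth X" "smooth Y"
  shows "vf_bracket X Y q $ j = lie_deriv X (\<lambda>q. Y q $ j) q - lie_deriv Y (\<lambda>q. X q $ j) q"
  using assms by (simp add: vf_bracket_def lie_deriv_vec_nth)

text \<open>In coordinates the second-order terms of the two iterated derivatives agree by symmetry of the
  second derivatives, and the first-order terms are the coefficients of the bracket.\<close>

lemma lie_deriv_commutator:
  assumes X: "smooth X" and Y: "smooth Y" and g: "smooth g"
  shows "lie_deriv X (lie_deriv Y g) q = lie_deriv Y (lie_deriv X g) q + lie_deriv (vf_bracket X Y) g q"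
proof -
  let ?d = "\<lambda>i. dir_deriv (axis i 1)"
  have second: "lie_deriv X (lie_deriv Y g) q =
      (\<Sum>j\<in>UNIV. lie_deriv X (\<lambda>q. Y q $ j) q * ?d j g q)
      + (\<Sum>j\<in>UNIV. \<Sum>i\<in>UNIV. X q $ i * Y q $ j * ?d i (?d j g) q)"
    if "smooth X" "smooth Y" for X Y
  proof -
    have "lie_deriv Y g = (\<lambda>q. Y q $ 1 * ?d 1 g q + Y q $ 2 * ?d 2 g q + Y q $ 3 * ?d 3 g q)"
      using lie_deriv_axis_expansion[OF g, of Y] by (simp add: sum_3 fun_eq_iff)
    then have "lie_deriv X (lie_deriv Y g) q =
        (\<Sum>j\<in>UNIV. lie_deriv X (\<lambda>q. Y q $ j) q * ?d j g q + Y q $ j * lie_deriv X (?d j g) q)"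
      using that g
      by (simp add: smooth_add smooth_mult smooth_vec_nth smooth_dir_deriv sum_3 del: lie_deriv_coord)
    also have "\<dots> = (\<Sum>j\<in>UNIV. lie_deriv X (\<lambda>q. Y q $ j) q * ?d j g q
        + (\<Sum>i\<in>UNIV. X q $ i * Y q $ j * ?d i (?d j g) q))"
      using lie_deriv_axis_expansion[OF smooth_dir_deriv[OF g]]
      by (simp add: sum_distrib_left mult_ac)
    finally show ?thesis by (simp add: sum.distrib)
  qed
  have "(\<Sum>j\<in>UNIV. \<Sum>i\<in>UNIV. X q $ i * Y q $ j * ?d i (?d j g) q)
      = (\<Sum>j\<in>UNIV. \<Sum>i\<in>UNIV. Y q $ i * X q $ j * ?d i (?d j g) q)"
    using dir_deriv_commute[OF g] by (subst sum.swap) (simp add: mult_ac)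
  moreover have "lie_deriv (vf_bracket X Y) g q = (\<Sum>j\<in>UNIV. lie_deriv X (\<lambda>q. Y q $ j) q * ?d j g q)
      - (\<Sum>j\<in>UNIV. lie_deriv Y (\<lambda>q. X q $ j) q * ?d j g q)"
    using lie_deriv_axis_expansion[OF g, of "vf_bracket X Y"]
    by (simp add: vf_bracket_nth X Y left_diff_distrib sum_subtractf)
  ultimately show ?thesis using second[OF X Y] second[OF Y X] by simp
qed

section \<open>The Heisenberg frame\<close>

lemma smooth_coord [intro, simp]: "smooth (\<lambda>q::real^3. q $ i)"
  by (rule smooth_vec_nth) (rule smooth_id)

lemmas smooth_intros = smooth_add smooth_diff smooth_minus smooth_mult smooth_divide smooth_power
  smooth_const smooth_coord

lemma heis_nth [simp]:
  "heis_f1 q $ 1 = 0" "heis_f1 q $ 2 = 1" "heis_f1 q $ 3 = q $ 1 / 2"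
  "heis_f2 q $ 1 = 1" "heis_f2 q $ 2 = 0" "heis_f2 q $ 3 = - (q $ 2 / 2)"
  by (simp_all add: heis_f1_def heis_f2_def)

lemma smooth_vec3:
  fixes f :: "real^3 \<Rightarrow> real^3"
  assumes "smooth (\<lambda>q. f q $ 1)" "smooth (\<lambda>q. f q $ 2)" "smooth (\<lambda>q. f q $ 3)"
  shows "smooth f"
  by (rule smooth_vec) (metis assms exhaust_3)

lemma smooth_heis [intro, simp]: "smooth heis_f1" "smooth heis_f2"
  by (auto intro!: smooth_vec3 simp: smooth_divide smooth_vec_nth smooth_id smooth_minus)

definition heis_f0 :: vector_field where "heis_f0 = (\<lambda>q. axis 3 1)"

lemma smooth_heis_f0 [intro, simp]: "smooth heis_f0"
  by (auto simp: heis_f0_def)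

lemma heis_f0_nth [simp]: "heis_f0 q $ 1 = 0" "heis_f0 q $ 2 = 0" "heis_f0 q $ 3 = 1"
  by (simp_all add: heis_f0_def axis_def)

abbreviation D1 :: "(real^3 \<Rightarrow> real) \<Rightarrow> real^3 \<Rightarrow> real" where "D1 \<equiv> lie_deriv heis_f1"
abbreviation D2 :: "(real^3 \<Rightarrow> real) \<Rightarrow> real^3 \<Rightarrow> real" where "D2 \<equiv> lie_deriv heis_f2"
abbreviation D0 :: "(real^3 \<Rightarrow> real) \<Rightarrow> real^3 \<Rightarrow> real" where "D0 \<equiv> lie_deriv heis_f0"

lemma D_commute:
  assumes "smooth g"
  shows "D1 (D2 g) = (\<lambda>q. D2 (D1 g) q - D0 g q)" "D1 (D0 g) = D0 (D1 g)" "D2 (D0 g) = D0 (D2 g)"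
proof -
  have lin: "linear (frechet_derivative g (at q))" for q
    using linear_frechet_derivative smooth_differentiable[OF assms] by blast
  have "vf_bracket heis_f1 heis_f2 q = - heis_f0 q" "vf_bracket heis_f1 heis_f0 q = 0"
    "vf_bracket heis_f2 heis_f0 q = 0" for q
    by (simp_all add: vec_eq_iff forall_3 vf_bracket_nth smooth_intros)
  then have "lie_deriv (vf_bracket heis_f1 heis_f2) g q = - D0 g q"
    "lie_deriv (vf_bracket heis_f1 heis_f0) g q = 0" "lie_deriv (vf_bracket heis_f2 heis_f0) g q = 0" for q
    by (simp_all add: lie_deriv_def linear_neg[OF lin] linear_0[OF lin])
  then show "D1 (D2 g) = (\<lambda>q. D2 (D1 g) q - D0 g q)" "D1 (D0 g) = D0 (D1 g)" "D2 (D0 g) = D0 (D2 g)"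
    using lie_deriv_commutator[OF smooth_heis(1) smooth_heis(2) assms]
      lie_deriv_commutator[OF smooth_heis(1) smooth_heis_f0 assms]
      lie_deriv_commutator[OF smooth_heis(2) smooth_heis_f0 assms]
    by (auto simp: fun_eq_iff)
qed

text \<open>The commutator of the two horizontal fields is the missing third direction, so vanishing
  horizontal derivatives force the whole derivative to vanish.\<close>

lemma horizontally_constant:
  assumes g: "smooth g" and D: "D1 g = (\<lambda>q. 0)" "D2 g = (\<lambda>q. 0)"
  shows "g q = g 0"
proof -
  have D0: "D0 g q = 0" for q
    using fun_cong[OF D_commute(1)[OF g], of q] by (simp add: D)
  have "frechet_derivative g (at q) v = 0" for q v
  proof -
    have lin: "linear (frechet_derivative g (at q))"
      using linear_frechet_derivative smooth_differentiable[OF g] by blast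
    have "v = v $ 2 *\<^sub>R heis_f1 q + v $ 1 *\<^sub>R heis_f2 q
        + (v $ 3 - v $ 2 * q $ 1 / 2 + v $ 1 * q $ 2 / 2) *\<^sub>R heis_f0 q"
      by (simp add: vec_eq_iff forall_3)
    moreover have "frechet_derivative g (at q) (v $ 2 *\<^sub>R heis_f1 q + v $ 1 *\<^sub>R heis_f2 q
        + (v $ 3 - v $ 2 * q $ 1 / 2 + v $ 1 * q $ 2 / 2) *\<^sub>R heis_f0 q) = 0"
      using D0 fun_cong[OF D(1)] fun_cong[OF D(2)]
      by (simp add: linear_add[OF lin] linear_cmul[OF lin] lie_deriv_def)
    ultimately show ?thesis by simp
  qed
  then have "frechet_derivative g (at q) = (\<lambda>v. 0)" for q by blast
  then have "(g has_derivative (\<lambda>v. 0)) (at q within UNIV)" for q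
    using smooth_frechet[OF g, of q] by simp
  then show ?thesis
    using has_derivative_zero_constant[OF convex_UNIV, of g] by (metis UNIV_I)
qed

lemma equal_up_to_constant:
  assumes g: "smooth g" "smooth h" and D: "D1 g = D1 h" "D2 g = D2 h"
  obtains c where "g = (\<lambda>q. c + h q)"
proof
  have "g q - h q = g 0 - h 0" for q
    by (rule horizontally_constant[where g = "\<lambda>q. g q - h q"]) (use assms in auto)
  then show "g = (\<lambda>q. (g 0 - h 0) + h q)" by (simp add: fun_eq_iff algebra_simps)
qed

section \<open>Conformal fields have contact potentials\<close>

lemma fibre_linear_differentiable:
  assumes "Y differentiable (at (fst l))"
  shows "fibre_linear Y differentiable (at l)"
proof -
  have "(\<lambda>l. Y (fst l)) differentiable (at l)"
    using assms differentiable_chain_at[of fst l Y]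
    by (simp add: o_def bounded_linear_fst bounded_linear_imp_differentiable)
  then have "(\<lambda>l. snd l \<bullet> Y (fst l)) differentiable (at l)"
    by (intro differentiable_inner) (simp_all add: bounded_linear_snd bounded_linear_imp_differentiable)
  then show ?thesis by (simp add: fibre_linear_def case_prod_unfold)
qed

lemma poisson_half_sum_squares:
  assumes "G differentiable (at l)" "H differentiable (at l)"
  shows "poisson F (\<lambda>l. ((G l)\<^sup>2 + (H l)\<^sup>2) / 2) l = G l * poisson F G l + H l * poisson F H l"
proof -
  have "(G has_derivative frechet_derivative G (at l)) (at l)"
    "(H has_derivative frechet_derivative H (at l)) (at l)"
    using assms by (simp_all add: frechet_derivative_works)
  then have "((\<lambda>l. ((G l)\<^sup>2 + (H l)\<^sup>2) / 2) has_derivative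
      (\<lambda>v. G l * frechet_derivative G (at l) v + H l * frechet_derivative H (at l) v)) (at l)"
    by (auto intro!: derivative_eq_intros simp: field_simps)
  from frechet_derivative_at[OF this, symmetric] show ?thesis
    by (simp add: poisson_def base_deriv_def fibre_deriv_def sum_3 algebra_simps)
qed

text \<open>By the Leibniz rule the bracket equals
  \<open>f\<^sub>1\<^sup>* [X, f\<^sub>1]\<^sup>* + f\<^sub>2\<^sup>* [X, f\<^sub>2]\<^sup>*\<close>; the right-hand side writes this out in the coordinates of the
  covector \<open>p\<close>.\<close>

lemma poisson_hamiltonian:
  assumes X: "smooth X"
  shows "poisson (fibre_linear X) heis_hamiltonian (q, p)
    = (p$2 + q$1 / 2 * p$3) * (p$3 * (X q $ 1 / 2) - p$1 * D1 (\<lambda>q. X q $ 1) q - p$2 * D1 (\<lambda>q. X q $ 2) q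
        - p$3 * D1 (\<lambda>q. X q $ 3) q)
    + (p$1 - q$2 / 2 * p$3) * (- p$3 * (X q $ 2 / 2) - p$1 * D2 (\<lambda>q. X q $ 1) q - p$2 * D2 (\<lambda>q. X q $ 2) q
        - p$3 * D2 (\<lambda>q. X q $ 3) q)"
proof -
  have "poisson (fibre_linear X) heis_hamiltonian (q, p)
    = fibre_linear heis_f1 (q, p) * fibre_linear (vf_bracket X heis_f1) (q, p)
    + fibre_linear heis_f2 (q, p) * fibre_linear (vf_bracket X heis_f2) (q, p)"
    unfolding heis_hamiltonian_def
    by (simp add: poisson_half_sum_squares fibre_linear_differentiable smooth_differentiable
        poisson_fibre_linear X)
  also have "\<dots> = fibre_linear heis_f1 (q, p) *
      (p$1 * (vf_bracket X heis_f1 q $ 1) + p$2 * (vf_bracket X heis_f1 q $ 2) + p$3 * (vf_bracket X heis_f1 q $ 3))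
    + fibre_linear heis_f2 (q, p) *
      (p$1 * (vf_bracket X heis_f2 q $ 1) + p$2 * (vf_bracket X heis_f2 q $ 2) + p$3 * (vf_bracket X heis_f2 q $ 3))"
    by (simp add: fibre_linear_def inner_vec_def sum_3)
  also have "\<dots> = (p$2 + q$1 / 2 * p$3) * (- p$1 * D1 (\<lambda>q. X q $ 1) q - p$2 * D1 (\<lambda>q. X q $ 2) q
        + p$3 * (X q $ 1 / 2 - D1 (\<lambda>q. X q $ 3) q))
    + (p$1 - q$2 / 2 * p$3) * (- p$1 * D2 (\<lambda>q. X q $ 1) q - p$2 * D2 (\<lambda>q. X q $ 2) q
        + p$3 * (- (X q $ 2 / 2) - D2 (\<lambda>q. X q $ 3) q))"
    by (simp add: vf_bracket_nth X smooth_intros fibre_linear_def inner_vec_def sum_3 mult.commute)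
  finally show ?thesis by (simp add: algebra_simps)
qed

lemma heis_hamiltonian_eq:
  "heis_hamiltonian (q, p) = ((p$2 + q$1 / 2 * p$3)\<^sup>2 + (p$1 - q$2 / 2 * p$3)\<^sup>2) / 2"
  by (simp add: heis_hamiltonian_def fibre_linear_def inner_vec_def sum_3 algebra_simps)

text \<open>Both sides of \<open>{X\<^sup>*, h} = 2 \<eta> h\<close> are quadratic in the three momenta \<open>h\<^sub>1, h\<^sub>2, h\<^sub>0\<close>. The
  coefficients of \<open>h\<^sub>1\<^sup>2\<close> and \<open>h\<^sub>2\<^sup>2\<close> both equal \<open>\<eta>\<close>, that of \<open>h\<^sub>1 h\<^sub>2\<close> vanishes, and those of \<open>h\<^sub>1 h\<^sub>0\<close> and
  \<open>h\<^sub>2 h\<^sub>0\<close> say that \<open>X\<close> preserves the contact distribution.\<close>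

lemma conf_heis_iff:
  "X \<in> conf_heis \<longleftrightarrow> smooth X \<and> (\<forall>q.
      D1 (\<lambda>q. X q $ 1) q = - D2 (\<lambda>q. X q $ 2) q \<and> D1 (\<lambda>q. X q $ 2) q = D2 (\<lambda>q. X q $ 1) q \<and>
      D1 (\<lambda>q. X q $ 3) q = X q $ 1 / 2 + q$1 / 2 * D1 (\<lambda>q. X q $ 2) q - q$2 / 2 * D1 (\<lambda>q. X q $ 1) q \<and>
      D2 (\<lambda>q. X q $ 3) q = - (X q $ 2 / 2) + q$1 / 2 * D2 (\<lambda>q. X q $ 2) q - q$2 / 2 * D2 (\<lambda>q. X q $ 1) q)"
  (is "_ \<longleftrightarrow> smooth X \<and> (\<forall>q. ?E q)")
proof safe
  assume "X \<in> conf_heis"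
  then obtain \<eta> where X: "smooth X" and
    eq: "poisson (fibre_linear X) heis_hamiltonian = (\<lambda>l. 2 * \<eta> (fst l) * heis_hamiltonian l)"
    by (auto simp: conf_heis_def)
  show "smooth X" by fact
  fix q
  note e = fun_cong[OF eq, unfolded fst_conv, of "(q, p)" for p,
      unfolded poisson_hamiltonian[OF X] heis_hamiltonian_eq fst_conv]
  \<comment> \<open>The covectors have momenta \<open>(h\<^sub>1, h\<^sub>2, h\<^sub>0)\<close> equal to \<open>(1,0,0)\<close>, \<open>(0,1,0)\<close>, \<open>(1,1,0)\<close>, \<open>(1,0,1)\<close>
    and \<open>(0,1,1)\<close>, where \<open>p = (h\<^sub>2 + y h\<^sub>0 / 2, h\<^sub>1 - x h\<^sub>0 / 2, h\<^sub>0)\<close>.\<close>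
  have "- D1 (\<lambda>q. X q $ 2) q = \<eta> q" "- D2 (\<lambda>q. X q $ 1) q = \<eta> q"
    "- D1 (\<lambda>q. X q $ 1) q - D1 (\<lambda>q. X q $ 2) q - D2 (\<lambda>q. X q $ 1) q - D2 (\<lambda>q. X q $ 2) q = 2 * \<eta> q"
    "X q $ 1 / 2 - q$2 / 2 * D1 (\<lambda>q. X q $ 1) q - (1 - q$1/2) * D1 (\<lambda>q. X q $ 2) q
        - D1 (\<lambda>q. X q $ 3) q = \<eta> q"
    "- (X q $ 2 / 2) - (1 + q$2 / 2) * D2 (\<lambda>q. X q $ 1) q + q$1/2 * D2 (\<lambda>q. X q $ 2) q
        - D2 (\<lambda>q. X q $ 3) q = \<eta> q"
    using e[of "vector [0, 1, 0]"] e[of "vector [1, 0, 0]"] e[of "vector [1, 1, 0]"]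
      e[of "vector [q$2/2, 1 - q$1/2, 1]"] e[of "vector [1 + q$2/2, - (q$1/2), 1]"]
    by (simp_all)
  then show "D1 (\<lambda>q. X q $ 1) q = - D2 (\<lambda>q. X q $ 2) q" "D1 (\<lambda>q. X q $ 2) q = D2 (\<lambda>q. X q $ 1) q"
      "D1 (\<lambda>q. X q $ 3) q = X q $ 1 / 2 + q$1 / 2 * D1 (\<lambda>q. X q $ 2) q - q$2 / 2 * D1 (\<lambda>q. X q $ 1) q"
      "D2 (\<lambda>q. X q $ 3) q = - (X q $ 2 / 2) + q$1 / 2 * D2 (\<lambda>q. X q $ 2) q - q$2 / 2 * D2 (\<lambda>q. X q $ 1) q"
    by (simp_all add: algebra_simps)
next
  assume X: "smooth X" and E: "\<forall>q. ?E q"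
  then have E1: "D1 (\<lambda>q. X q $ 1) q = - D2 (\<lambda>q. X q $ 2) q"
    and E2: "D1 (\<lambda>q. X q $ 2) q = D2 (\<lambda>q. X q $ 1) q"
    and E3: "D1 (\<lambda>q. X q $ 3) q = X q $ 1 / 2 + q$1 / 2 * D2 (\<lambda>q. X q $ 1) q + q$2 / 2 * D2 (\<lambda>q. X q $ 2) q"
    and E4: "D2 (\<lambda>q. X q $ 3) q = - (X q $ 2 / 2) + q$1 / 2 * D2 (\<lambda>q. X q $ 2) q - q$2 / 2 * D2 (\<lambda>q. X q $ 1) q"
    for q by simp_all
  have "poisson (fibre_linear X) heis_hamiltonian (q, p)
      = 2 * (- D1 (\<lambda>q. X q $ 2) q) * heis_hamiltonian (q, p)" for q p
    unfolding poisson_hamiltonian[OF X] heis_hamiltonian_eq E1 E2 E3 E4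
    by (simp add: field_simps power2_eq_square)
  then have "poisson (fibre_linear X) heis_hamiltonian
      = (\<lambda>l. 2 * (- D1 (\<lambda>q. X q $ 2) (fst l)) * heis_hamiltonian l)"
    by (auto simp: fun_eq_iff)
  moreover have "smooth (\<lambda>q. - D1 (\<lambda>q. X q $ 2) q)"
    using X by (intro smooth_minus smooth_lie_deriv smooth_vec_nth smooth_heis)
  ultimately show "X \<in> conf_heis" unfolding conf_heis_def using X by blast
qed

text \<open>The field \<open>- f\<^sub>2(g) f\<^sub>1 + f\<^sub>1(g) f\<^sub>2 + g f\<^sub>0\<close>. It is the only field \<open>X\<close> whose flow preserves the contact
  distribution and for which \<open>dz + (y dx - x dy) / 2\<close> takes the value \<open>g\<close>.\<close>

definition contact_field :: "(real^3 \<Rightarrow> real) \<Rightarrow> vector_field"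
  where "contact_field g = (\<lambda>q. vector [D1 g q, - D2 g q, g q - (q$1 * D2 g q + q$2 * D1 g q) / 2])"

text \<open>With \<open>Z = f\<^sub>2 + i f\<^sub>1\<close> the two equations together say \<open>Z Z g = 0\<close>.\<close>

definition conformal_potential :: "(real^3 \<Rightarrow> real) \<Rightarrow> bool"
  where "conformal_potential g \<longleftrightarrow> smooth g \<and> D1 (D1 g) = D2 (D2 g) \<and> D1 (D2 g) = (\<lambda>q. - D2 (D1 g) q)"

lemma conf_heis_eq_contact_fields: "conf_heis = contact_field ` Collect conformal_potential"
proof (intro equalityI subsetI)
  fix X assume "X \<in> conf_heis"
  then have X: "smooth X" and
    E: "D1 (\<lambda>q. X q $ 1) q = - D2 (\<lambda>q. X q $ 2) q" "D1 (\<lambda>q. X q $ 2) q = D2 (\<lambda>q. X q $ 1) q"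
      "D1 (\<lambda>q. X q $ 3) q = X q $ 1 / 2 + q$1 / 2 * D1 (\<lambda>q. X q $ 2) q - q$2 / 2 * D1 (\<lambda>q. X q $ 1) q"
      "D2 (\<lambda>q. X q $ 3) q = - (X q $ 2 / 2) + q$1 / 2 * D2 (\<lambda>q. X q $ 2) q - q$2 / 2 * D2 (\<lambda>q. X q $ 1) q"
    for q by (simp_all add: conf_heis_iff)
  have [simp]: "smooth (\<lambda>q. X q $ i)" for i using X by blast
  define g where "g = (\<lambda>q. X q $ 3 - q$1 * X q $ 2 / 2 + q$2 * X q $ 1 / 2)"
  have g: "smooth g" unfolding g_def by (intro smooth_add smooth_diff smooth_divide smooth_mult) auto
  have d: "D1 g = (\<lambda>q. X q $ 1)" "D2 g = (\<lambda>q. - X q $ 2)"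
    unfolding g_def
    by (simp_all add: smooth_add smooth_diff smooth_divide smooth_mult E fun_eq_iff algebra_simps)
      (simp_all add: field_simps)
  have "conformal_potential g"
    unfolding conformal_potential_def d using g by (simp add: E fun_eq_iff)
  moreover have "X = contact_field g"
    by (simp add: contact_field_def fun_eq_iff vec_eq_iff forall_3 d) (simp add: g_def field_simps)
  ultimately show "X \<in> contact_field ` Collect conformal_potential" by blast
next
  fix X assume "X \<in> contact_field ` Collect conformal_potential"
  then obtain g where g: "smooth g" "D1 (D1 g) = D2 (D2 g)" "D1 (D2 g) = (\<lambda>q. - D2 (D1 g) q)"
    and X: "X = contact_field g"
    by (auto simp: conformal_potential_def)
  have nth: "contact_field g q $ 1 = D1 g q" "contact_field g q $ 2 = - D2 g q"
    "contact_field g q $ 3 = g q - (q$1 * D2 g q + q$2 * D1 g q) / 2" for q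
    by (simp_all add: contact_field_def)
  have s: "smooth (D1 g)" "smooth (D2 g)" using g by auto
  have "smooth (contact_field g)"
    by (rule smooth_vec3) (auto simp: nth intro!: smooth_diff smooth_add smooth_minus smooth_divide smooth_mult s g)
  then show "X \<in> conf_heis"
    unfolding conf_heis_iff X nth
    by (simp add: s g smooth_intros) (simp add: field_simps)
qed

section \<open>The eight-dimensional space of potentials\<close>

text \<open>The parameters are integration constants, one for each function of the closed system, with
  \<open>k7\<close> the value of \<open>f\<^sub>0 f\<^sub>0 g\<close>. The polynomials after this one are its derivatives \<open>f\<^sub>1 g\<close>,
  \<open>f\<^sub>2 g\<close>, \<open>f\<^sub>1 f\<^sub>1 g\<close> and \<open>f\<^sub>0 g\<close>. Each is a constant plus the rest, the shape in which a
  function is recovered from its horizontal derivatives.\<close>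

definition potential :: "real \<Rightarrow> real \<Rightarrow> real \<Rightarrow> real \<Rightarrow> real \<Rightarrow> real \<Rightarrow> real \<Rightarrow> real \<Rightarrow> real^3 \<Rightarrow> real"
  where "potential k0 k1 k2 k3 k4 k5 k6 k7 = (\<lambda>q.
    k0 + (k1 * q$1 + k2 * q$2 + k3 * q$3 + k4 * (((q$1)\<^sup>2 + (q$2)\<^sup>2) / 2)
    + k5 * (q$2 * q$3 + q$1 * ((q$1)\<^sup>2 + (q$2)\<^sup>2) / 4)
    + k6 * (q$1 * q$3 - q$2 * ((q$1)\<^sup>2 + (q$2)\<^sup>2) / 4)
    + k7 * ((q$3)\<^sup>2 / 2 + ((q$1)\<^sup>2 + (q$2)\<^sup>2)\<^sup>2 / 32)))"

definition potential_D1 :: "real \<Rightarrow> real \<Rightarrow> real \<Rightarrow> real \<Rightarrow> real \<Rightarrow> real \<Rightarrow> real^3 \<Rightarrow> real"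
  where "potential_D1 k2 k3 k4 k5 k6 k7 = (\<lambda>q.
    k2 + (k3 * q$1 / 2 + k4 * q$2 + k5 * (q$1 * q$2 + q$3) + k6 * ((q$1)\<^sup>2 - 3 * (q$2)\<^sup>2) / 4
    + k7 * (q$1 * q$3 / 2 + q$2 * ((q$1)\<^sup>2 + (q$2)\<^sup>2) / 8)))"

definition potential_D2 :: "real \<Rightarrow> real \<Rightarrow> real \<Rightarrow> real \<Rightarrow> real \<Rightarrow> real \<Rightarrow> real^3 \<Rightarrow> real"
  where "potential_D2 k1 k3 k4 k5 k6 k7 = (\<lambda>q.
    k1 + (- (k3 * q$2 / 2) + k4 * q$1 + k5 * (3 * (q$1)\<^sup>2 - (q$2)\<^sup>2) / 4 + k6 * (q$3 - q$1 * q$2)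
    + k7 * (q$1 * ((q$1)\<^sup>2 + (q$2)\<^sup>2) / 8 - q$2 * q$3 / 2)))"

definition potential_D11 :: "real \<Rightarrow> real \<Rightarrow> real \<Rightarrow> real \<Rightarrow> real^3 \<Rightarrow> real"
  where "potential_D11 k4 k5 k6 k7 = (\<lambda>q.
    k4 + (3/2 * k5 * q$1 - 3/2 * k6 * q$2 + 3/8 * k7 * ((q$1)\<^sup>2 + (q$2)\<^sup>2)))"

definition potential_D0 :: "real \<Rightarrow> real \<Rightarrow> real \<Rightarrow> real \<Rightarrow> real^3 \<Rightarrow> real"
  where "potential_D0 k3 k5 k6 k7 = (\<lambda>q. k3 + (k5 * q$2 + k6 * q$1 + k7 * q$3))"

lemmas potential_defs = potential_def potential_D1_def potential_D2_def potential_D11_def potential_D0_def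

lemma smooth_potential [simp]:
  "smooth (potential k0 k1 k2 k3 k4 k5 k6 k7)" "smooth (potential_D1 k2 k3 k4 k5 k6 k7)"
  "smooth (potential_D2 k1 k3 k4 k5 k6 k7)" "smooth (potential_D11 k4 k5 k6 k7)"
  "smooth (potential_D0 k3 k5 k6 k7)"
  unfolding potential_defs by (intro smooth_intros)+

lemma D_potential_D0:
  "D1 (potential_D0 k3 k5 k6 k7) = (\<lambda>q. k5 + k7 / 2 * q$1)"
  "D2 (potential_D0 k3 k5 k6 k7) = (\<lambda>q. k6 - k7 / 2 * q$2)"
  by (simp_all add: potential_defs smooth_intros fun_eq_iff algebra_simps)

lemma D_potential_D11:
  "D1 (potential_D11 k4 k5 k6 k7) = (\<lambda>q. - 3/2 * (k6 - k7 / 2 * q$2))"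
  "D2 (potential_D11 k4 k5 k6 k7) = (\<lambda>q. 3/2 * (k5 + k7 / 2 * q$1))"
  by (simp_all add: potential_defs smooth_intros fun_eq_iff algebra_simps)

lemma D_potential_D1:
  "D1 (potential_D1 k2 k3 k4 k5 k6 k7) = potential_D11 k4 k5 k6 k7"
  "D2 (potential_D1 k2 k3 k4 k5 k6 k7) = (\<lambda>q. potential_D0 k3 k5 k6 k7 q / 2)"
  by (simp_all add: potential_defs smooth_intros fun_eq_iff field_simps power2_eq_square)

lemma D_potential_D2:
  "D1 (potential_D2 k1 k3 k4 k5 k6 k7) = (\<lambda>q. - (potential_D0 k3 k5 k6 k7 q / 2))"
  "D2 (potential_D2 k1 k3 k4 k5 k6 k7) = potential_D11 k4 k5 k6 k7"
  by (simp_all add: potential_defs smooth_intros fun_eq_iff field_simps power2_eq_square)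

lemma D_potential:
  "D1 (potential k0 k1 k2 k3 k4 k5 k6 k7) = potential_D1 k2 k3 k4 k5 k6 k7"
  "D2 (potential k0 k1 k2 k3 k4 k5 k6 k7) = potential_D2 k1 k3 k4 k5 k6 k7"
  by (simp_all add: potential_defs smooth_intros fun_eq_iff field_simps power2_eq_square)

lemma conformal_potential_potential: "conformal_potential (potential k0 k1 k2 k3 k4 k5 k6 k7)"
  by (simp add: conformal_potential_def D_potential D_potential_D1 D_potential_D2)

lemma potential_add_const:
  "(\<lambda>q. c + potential 0 k1 k2 k3 k4 k5 k6 k7 q) = potential c k1 k2 k3 k4 k5 k6 k7"
  "(\<lambda>q. c + potential_D1 0 k3 k4 k5 k6 k7 q) = potential_D1 c k3 k4 k5 k6 k7"
  "(\<lambda>q. c + potential_D2 0 k3 k4 k5 k6 k7 q) = potential_D2 c k3 k4 k5 k6 k7"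
  "(\<lambda>q. c + potential_D11 0 k5 k6 k7 q) = potential_D11 c k5 k6 k7"
  "(\<lambda>q. c + potential_D0 0 k5 k6 k7 q) = potential_D0 c k5 k6 k7"
  by (simp_all add: potential_defs)

text \<open>The equations fix \<open>f\<^sub>2 f\<^sub>1 g = f\<^sub>0 g / 2\<close> and \<open>f\<^sub>1 f\<^sub>2 g = - f\<^sub>0 g / 2\<close>, so only
  \<open>s = f\<^sub>1 f\<^sub>1 g = f\<^sub>2 f\<^sub>2 g\<close> is new at second order. The derivatives of \<open>s\<close> reduce to those of
  \<open>f\<^sub>0 g\<close>, and computing \<open>f\<^sub>0 s\<close> as a commutator gives \<open>f\<^sub>0 s = - 3 f\<^sub>0 s\<close>, hence \<open>f\<^sub>0 s = 0\<close>. The same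
  device then makes \<open>f\<^sub>0 f\<^sub>0 g\<close> constant, and the other functions follow by integration.\<close>

lemma conformal_potential_imp_potential:
  assumes "conformal_potential g"
  obtains k0 k1 k2 k3 k4 k5 k6 k7 where "g = potential k0 k1 k2 k3 k4 k5 k6 k7"
proof -
  from assms have g [simp]: "smooth g" and H: "D1 (D1 g) = D2 (D2 g)" "D1 (D2 g) = (\<lambda>q. - D2 (D1 g) q)"
    by (simp_all add: conformal_potential_def)
  have sm [simp]: "smooth f \<Longrightarrow> smooth (D1 f)" "smooth f \<Longrightarrow> smooth (D2 f)" "smooth f \<Longrightarrow> smooth (D0 f)" for f
    by auto
  note comm = D_commute[THEN fun_cong]
  define s where "s = D1 (D1 g)"
  have [simp]: "smooth s" by (simp add: s_def)
  have b: "D2 (D1 g) = (\<lambda>q. D0 g q / 2)"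
    using comm(1)[OF g] H(2) by (auto simp: fun_eq_iff field_simps)
  have a: "D1 (D2 g) = (\<lambda>q. - (D0 g q / 2))" using H(2) b by simp
  have as: "D1 s = (\<lambda>q. - 3/2 * D0 (D2 g) q)"
  proof
    fix q
    have "D1 s q = D2 (D1 (D2 g)) q - D0 (D2 g) q"
      unfolding s_def H(1) by (rule comm) simp
    then show "D1 s q = - 3/2 * D0 (D2 g) q" by (simp add: a D_commute smooth_divide)
  qed
  have bs: "D2 s = (\<lambda>q. 3/2 * D0 (D1 g) q)"
  proof
    fix q
    have "D2 s q = D1 (D2 (D1 g)) q + D0 (D1 g) q"
      using comm(1)[of "D1 g" q] by (simp add: s_def)
    then show "D2 s q = 3/2 * D0 (D1 g) q" by (simp add: b D_commute smooth_divide)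
  qed
  have ts: "D0 s = (\<lambda>q. 0)"
  proof
    fix q
    have "D0 s q = D2 (D1 s) q - D1 (D2 s) q" using comm(1)[of s q] by simp
    also have "\<dots> = - 3/2 * D0 (D2 (D2 g)) q - 3/2 * D0 (D1 (D1 g)) q"
      by (simp add: as bs D_commute smooth_intros)
    also have "\<dots> = - 3 * D0 s q" by (simp add: s_def H(1))
    finally show "D0 s q = 0" by simp
  qed
  have ta: "D1 (D0 (D1 g)) = (\<lambda>q. 0)" "D2 (D0 (D1 g)) = (\<lambda>q. D0 (D0 g) q / 2)"
    using ts by (simp_all add: D_commute b flip: s_def)
  have tb: "D1 (D0 (D2 g)) = (\<lambda>q. - (D0 (D0 g) q / 2))" "D2 (D0 (D2 g)) = (\<lambda>q. 0)"
    using ts by (simp_all add: D_commute(2,3) a smooth_intros flip: H(1)) (simp add: s_def)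
  have tt: "D1 (D0 (D0 g)) q = 0" "D2 (D0 (D0 g)) q = 0" for q
  proof -
    have "D0 (D0 (D1 g)) q = - (D1 (D0 (D0 g)) q / 2)"
      using comm(1)[of "D0 (D1 g)" q] ta by (simp add: smooth_intros)
    then show "D1 (D0 (D0 g)) q = 0" by (simp add: D_commute)
    have "D0 (D0 (D2 g)) q = - (D2 (D0 (D0 g)) q / 2)"
      using comm(1)[of "D0 (D2 g)" q] tb by (simp add: smooth_intros)
    then show "D2 (D0 (D0 g)) q = 0" by (simp add: D_commute)
  qed
  \<comment> \<open>The system is now closed. It is integrated from \<open>f\<^sub>0 f\<^sub>0 g\<close> down to \<open>g\<close>, and each step matches
    the horizontal derivatives of one function with those of a polynomial.\<close>
  obtain k7 where k7: "D0 (D0 g) = (\<lambda>q. k7)"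
    using horizontally_constant[of "D0 (D0 g)"] tt by (metis (mono_tags) ext g sm(3))
  obtain k5 where k5: "D0 (D1 g) = (\<lambda>q. k5 + k7 / 2 * q$1)"
    by (rule equal_up_to_constant[of "D0 (D1 g)" "\<lambda>q. k7 / 2 * q$1"])
      (auto simp: ta k7 smooth_intros)
  obtain k6 where k6: "D0 (D2 g) = (\<lambda>q. k6 + - (k7 / 2 * q$2))"
    by (rule equal_up_to_constant[of "D0 (D2 g)" "\<lambda>q. - (k7 / 2 * q$2)"])
      (auto simp: tb k7 smooth_intros)
  obtain k3 where k3: "D0 g = potential_D0 k3 k5 k6 k7"
    using equal_up_to_constant[of "D0 g" "potential_D0 0 k5 k6 k7"]
    by (auto simp: D_commute k5 k6 D_potential_D0 potential_add_const)
  obtain k4 where k4: "s = potential_D11 k4 k5 k6 k7"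
    using equal_up_to_constant[of s "potential_D11 0 k5 k6 k7"]
    by (auto simp: as bs k5 k6 D_potential_D11 potential_add_const)
  obtain k2 where k2: "D1 g = potential_D1 k2 k3 k4 k5 k6 k7"
    using equal_up_to_constant[of "D1 g" "potential_D1 0 k3 k4 k5 k6 k7"]
    by (auto simp: b k3 k4 D_potential_D1 potential_add_const simp flip: s_def)
  obtain k1 where k1: "D2 g = potential_D2 k1 k3 k4 k5 k6 k7"
    using equal_up_to_constant[of "D2 g" "potential_D2 0 k3 k4 k5 k6 k7"]
    by (auto simp: a k3 k4 D_potential_D2 potential_add_const simp flip: s_def H(1))
  obtain k0 where "g = potential k0 k1 k2 k3 k4 k5 k6 k7"
    using equal_up_to_constant[of g "potential 0 k1 k2 k3 k4 k5 k6 k7"]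
    by (auto simp: k1 k2 D_potential potential_add_const)
  then show ?thesis by (rule that)
qed

section \<open>The projective action of su(2,1) on the Heisenberg group\<close>

text \<open>Together with \<open>zcoord\<close> this embeds the Heisenberg group in \<open>\<complex>\<^sup>2\<close> as the hypersurface
  \<open>Re w = - |\<zeta>|\<^sup>2\<close>. That is the condition for \<open>(1 + w, 2 \<zeta>, 1 - w)\<close> to be a null vector of the form,
  and the factor \<open>- 4\<close> makes the maximal complex tangent planes of the hypersurface the planes
  spanned by the frame.\<close>

definition wcoord :: "real^3 \<Rightarrow> complex"
  where "wcoord q = - of_real ((q$1)\<^sup>2 + (q$2)\<^sup>2) - 4 * \<i> * of_real (q$3)"

definition zcoord :: "real^3 \<Rightarrow> complex"
  where "zcoord q = of_real (q$1) + \<i> * of_real (q$2)"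

text \<open>The \<open>i\<close>-th entry of \<open>M v\<close> for the null vector \<open>v = (1 + w, 2 \<zeta>, 1 - w)\<close>.\<close>

definition null_row :: "complex^3^3 \<Rightarrow> 3 \<Rightarrow> complex \<Rightarrow> complex \<Rightarrow> complex"
  where "null_row M i \<zeta> w = M$i$1 * (1 + w) + 2 * M$i$2 * \<zeta> + M$i$3 * (1 - w)"

text \<open>The first and third entries of \<open>v\<close> have constant sum \<open>2\<close>. This is the number \<open>\<mu>\<close> for which
  \<open>\<mu> v - M v\<close> is tangent to this normalisation, so that it is the velocity of \<open>v\<close> under the
  projective action. The sign of \<open>M v\<close> is negative because passing from linear maps to linear
  vector fields reverses brackets.\<close>

definition scaling :: "complex^3^3 \<Rightarrow> complex \<Rightarrow> complex \<Rightarrow> complex"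
  where "scaling M \<zeta> w = (null_row M 1 \<zeta> w + null_row M 3 \<zeta> w) / 2"

text \<open>The velocities of \<open>\<zeta>\<close> and \<open>w\<close> under this action, read off from the second and first entries of
  \<open>\<mu> v - M v\<close>.\<close>

definition zrate :: "complex^3^3 \<Rightarrow> complex \<Rightarrow> complex \<Rightarrow> complex"
  where "zrate M \<zeta> w = scaling M \<zeta> w * \<zeta> - null_row M 2 \<zeta> w / 2"

definition wrate :: "complex^3^3 \<Rightarrow> complex \<Rightarrow> complex \<Rightarrow> complex"
  where "wrate M \<zeta> w = scaling M \<zeta> w * (1 + w) - null_row M 1 \<zeta> w"

definition projective_field :: "complex^3^3 \<Rightarrow> vector_field"
  where "projective_field M = (\<lambda>q. vector [Re (zrate M (zcoord q) (wcoord q)), Im (zrate M (zcoord q) (wcoord q)),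
    - Im (wrate M (zcoord q) (wcoord q)) / 4])"

text \<open>The potential of the projective field of a matrix is, up to a constant factor, the imaginary
  Hermitian form \<open>\<langle>v, M v\<rangle>\<close>; expanding it in the coordinates gives the eight coefficients.\<close>

lemma projective_field_su21_matrix:
  "projective_field (su21_matrix a b u v s) = contact_field (potential
    ((a + b / 2 + Im v) / 4) ((Im u + Im s) / 2) ((Re u - Re s) / 2) (2 * Re v) (3 / 2 * b)
    (2 * (Im s - Im u)) (2 * (Re u + Re s)) (8 * a + 4 * b - 8 * Im v))"
  unfolding fun_eq_iff vec_eq_iff forall_3
  unfolding contact_field_def D_potential vector_3
  by (simp add: projective_field_def potential_defs zrate_def wrate_def scaling_def
      null_row_def zcoord_def wcoord_def su21_matrix_def field_simps power2_eq_square)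

text \<open>All eight coefficients can be read off from the values of the field at the origin, at \<open>(0,0,1)\<close>,
  at \<open>(1,0,0)\<close> and at \<open>(2,0,0)\<close>.\<close>

lemma inj_contact_potential:
  assumes "contact_field (potential k0 k1 k2 k3 k4 k5 k6 k7) = contact_field (potential l0 l1 l2 l3 l4 l5 l6 l7)"
  shows "k0 = l0 \<and> k1 = l1 \<and> k2 = l2 \<and> k3 = l3 \<and> k4 = l4 \<and> k5 = l5 \<and> k6 = l6 \<and> k7 = l7"
proof -
  note e = fun_cong[OF assms, THEN arg_cong[where f = "\<lambda>v. v $ i" for i], unfolded contact_field_def D_potential]
  have 0: "k2 = l2" "k1 = l1" "k0 = l0" using e[of 0 1] e[of 0 2] e[of 0 3]
    by (simp_all add: potential_defs)
  have 1: "k5 = l5" "k6 = l6" using e[of "vector [0,0,1]" 1] e[of "vector [0,0,1]" 2] 0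
    by (simp_all add: potential_defs)
  have 2: "k3 = l3" using e[of "vector [1,0,0]" 1] 0 1 by (simp add: potential_defs)
  have "8 * k4 + k7 = 8 * l4 + l7" "2 * k4 + k7 = 2 * l4 + l7"
    using e[of "vector [1,0,0]" 2] e[of "vector [2,0,0]" 2] 0 1 by (simp_all add: potential_defs)
  then show ?thesis using 0 1 2 by auto
qed

lemma inj_projective_field: "inj_on projective_field su21"
proof (rule inj_onI)
  fix A B assume "A \<in> su21" "B \<in> su21" and eq: "projective_field A = projective_field B"
  then obtain a b u v s a' b' u' v' s' where A: "A = su21_matrix a b u v s" and B: "B = su21_matrix a' b' u' v' s'"
    by (metis su21_cases)
  have "a = a' \<and> b = b' \<and> u = u' \<and> v = v' \<and> s = s'"
    using inj_contact_potential[OF eq[unfolded A B projective_field_su21_matrix]]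
    by (simp add: complex_eq_iff; linarith)
  then show "A = B" by (simp add: A B)
qed

text \<open>For surjectivity, the matrix with given potential is found by solving the linear equations in
  the entries that \<open>projective_field_su21_matrix\<close> provides.\<close>

lemma projective_field_image: "projective_field ` su21 = conf_heis"
proof (intro equalityI subsetI)
  fix X assume "X \<in> projective_field ` su21"
  then show "X \<in> conf_heis"
    using conformal_potential_potential unfolding conf_heis_eq_contact_fields
    by (auto elim!: su21_cases simp: projective_field_su21_matrix)
next
  fix X assume "X \<in> conf_heis"
  then obtain g where "conformal_potential g" and Xg: "X = contact_field g"
    by (auto simp: conf_heis_eq_contact_fields)
  from this(1) obtain k0 k1 k2 k3 k4 k5 k6 k7 where "g = potential k0 k1 k2 k3 k4 k5 k6 k7"
    by (rule conformal_potential_imp_potential)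
  then have X: "X = contact_field (potential k0 k1 k2 k3 k4 k5 k6 k7)"
    using Xg by simp
  have "X = projective_field (su21_matrix (2 * k0 + k7 / 16 - k4 / 3) (2 * k4 / 3)
      (Complex (k2 + k6 / 4) (k1 - k5 / 4)) (Complex (k3 / 2) (2 * k0 - k7 / 16))
      (Complex (k6 / 4 - k2) (k1 + k5 / 4)))"
    unfolding X projective_field_su21_matrix complex.sel
    by (simp add: field_simps)
  then show "X \<in> projective_field ` su21" using su21_matrix_in_su21 by blast
qed

lemma projective_field_add: "projective_field (A + B) = projective_field A + projective_field B"
  unfolding fun_eq_iff vec_eq_iff forall_3
  by (simp add: projective_field_def zrate_def wrate_def scaling_def null_row_def algebra_simps add_divide_distrib diff_divide_distrib)

lemma projective_field_scaleR: "projective_field (c *\<^sub>R A) = c *\<^sub>R projective_field A"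
proof -
  have "null_row (c *\<^sub>R A) i \<zeta> w = c *\<^sub>R null_row A i \<zeta> w" for i \<zeta> w
    by (simp add: null_row_def scaleR_add_right)
  then have "scaling (c *\<^sub>R A) \<zeta> w = c *\<^sub>R scaling A \<zeta> w" for \<zeta> w
    by (simp add: scaling_def scaleR_conv_of_real algebra_simps)
  then have "zrate (c *\<^sub>R A) \<zeta> w = c *\<^sub>R zrate A \<zeta> w" "wrate (c *\<^sub>R A) \<zeta> w = c *\<^sub>R wrate A \<zeta> w" for \<zeta> w
    using \<open>\<And>w i \<zeta>. null_row (c *\<^sub>R A) i \<zeta> w = _\<close>
    by (simp_all add: zrate_def wrate_def scaleR_diff_right)
  then show ?thesis
    by (simp add: fun_eq_iff vec_eq_iff forall_3 projective_field_def)
qed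

text \<open>This and the next three definitions are the differentials of \<open>null_row\<close>, \<open>scaling\<close>,
  \<open>zrate\<close> and \<open>wrate\<close> with respect to \<open>\<zeta>\<close> and \<open>w\<close>, at the increments \<open>d\<zeta>\<close> and \<open>dw\<close>.\<close>

definition null_row_deriv :: "complex^3^3 \<Rightarrow> 3 \<Rightarrow> complex \<Rightarrow> complex \<Rightarrow> complex"
  where "null_row_deriv M i d\<zeta> dw = M$i$1 * dw + 2 * M$i$2 * d\<zeta> - M$i$3 * dw"

definition scaling_deriv :: "complex^3^3 \<Rightarrow> complex \<Rightarrow> complex \<Rightarrow> complex"
  where "scaling_deriv M d\<zeta> dw = (null_row_deriv M 1 d\<zeta> dw + null_row_deriv M 3 d\<zeta> dw) / 2"

definition dzrate :: "complex^3^3 \<Rightarrow> complex \<Rightarrow> complex \<Rightarrow> complex \<Rightarrow> complex \<Rightarrow> complex"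
  where "dzrate M \<zeta> w d\<zeta> dw =
    scaling_deriv M d\<zeta> dw * \<zeta> + scaling M \<zeta> w * d\<zeta> - null_row_deriv M 2 d\<zeta> dw / 2"

definition dwrate :: "complex^3^3 \<Rightarrow> complex \<Rightarrow> complex \<Rightarrow> complex \<Rightarrow> complex \<Rightarrow> complex"
  where "dwrate M \<zeta> w d\<zeta> dw =
    scaling_deriv M d\<zeta> dw * (1 + w) + scaling M \<zeta> w * dw - null_row_deriv M 1 d\<zeta> dw"

text \<open>Along the action of \<open>M\<close> the vector \<open>v\<close> moves with velocity \<open>\<mu> v - M v\<close>, so \<open>N v\<close> moves with
  velocity \<open>\<mu> N v - N M v\<close>.\<close>

lemma null_row_deriv_rate:
  "null_row_deriv N i (zrate M \<zeta> w) (wrate M \<zeta> w) = scaling M \<zeta> w * null_row N i \<zeta> w - null_row (N ** M) i \<zeta> w"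
proof -
  have "2 * scaling M \<zeta> w = null_row M 1 \<zeta> w + null_row M 3 \<zeta> w"
    "2 * zrate M \<zeta> w = 2 * scaling M \<zeta> w * \<zeta> - null_row M 2 \<zeta> w"
    "wrate M \<zeta> w = scaling M \<zeta> w * (1 + w) - null_row M 1 \<zeta> w"
    by (simp_all add: scaling_def zrate_def wrate_def)
  then show ?thesis
    unfolding null_row_def null_row_deriv_def matrix_matrix_mult_def sum_3 vec_lambda_beta
    by algebra
qed

lemma scaling_deriv_rate:
  "scaling_deriv N (zrate M \<zeta> w) (wrate M \<zeta> w) = scaling M \<zeta> w * scaling N \<zeta> w - scaling (N ** M) \<zeta> w"
  unfolding scaling_deriv_def null_row_deriv_rate by (simp add: scaling_def field_simps)

text \<open>The terms with the scalings \<open>\<mu>\<close> are symmetric in \<open>M\<close> and \<open>N\<close> or cancel, which leaves the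
  difference of the contributions of \<open>M N\<close> and \<open>N M\<close>. This is an identity of polynomials in
  independent \<open>\<zeta>\<close> and \<open>w\<close>.\<close>

lemma rate_bracket:
  "dzrate N \<zeta> w (zrate M \<zeta> w) (wrate M \<zeta> w) - dzrate M \<zeta> w (zrate N \<zeta> w) (wrate N \<zeta> w)
    = zrate (commutator M N) \<zeta> w"
  "dwrate N \<zeta> w (zrate M \<zeta> w) (wrate M \<zeta> w) - dwrate M \<zeta> w (zrate N \<zeta> w) (wrate N \<zeta> w)
    = wrate (commutator M N) \<zeta> w"
proof -
  have row: "null_row (commutator M N) i \<zeta> w = null_row (M ** N) i \<zeta> w - null_row (N ** M) i \<zeta> w" for i
    by (simp add: commutator_def null_row_def left_diff_distrib right_diff_distrib)
  have scaling: "scaling (commutator M N) \<zeta> w = scaling (M ** N) \<zeta> w - scaling (N ** M) \<zeta> w"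
    by (simp add: scaling_def row field_simps)
  show "dzrate N \<zeta> w (zrate M \<zeta> w) (wrate M \<zeta> w) - dzrate M \<zeta> w (zrate N \<zeta> w) (wrate N \<zeta> w)
    = zrate (commutator M N) \<zeta> w"
    unfolding dzrate_def null_row_deriv_rate scaling_deriv_rate
    unfolding zrate_def row scaling by (simp add: field_simps)
  show "dwrate N \<zeta> w (zrate M \<zeta> w) (wrate M \<zeta> w) - dwrate M \<zeta> w (zrate N \<zeta> w) (wrate N \<zeta> w)
    = wrate (commutator M N) \<zeta> w"
    unfolding dwrate_def null_row_deriv_rate scaling_deriv_rate
    unfolding wrate_def row scaling by (simp add: field_simps)
qed

definition dwcoord :: "real^3 \<Rightarrow> real^3 \<Rightarrow> complex"
  where "dwcoord q v = - of_real (2 * (q$1 * v$1 + q$2 * v$2)) - 4 * \<i> * of_real (v$3)"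

lemma vec_nth_has_derivative: "((\<lambda>q. q $ i) has_derivative (\<lambda>v. v $ i)) (at q within S)"
  by (rule bounded_linear_imp_has_derivative[OF bounded_linear_vec_nth])

lemma zcoord_has_derivative: "(zcoord has_derivative zcoord) (at q)"
  unfolding zcoord_def [abs_def]
  by (auto intro!: derivative_eq_intros vec_nth_has_derivative)

lemma wcoord_has_derivative: "(wcoord has_derivative dwcoord q) (at q)"
  unfolding wcoord_def [abs_def] dwcoord_def [abs_def]
  by (auto intro!: derivative_eq_intros vec_nth_has_derivative simp: algebra_simps)

lemma null_row_has_derivative:
  "((\<lambda>q. null_row M i (zcoord q) (wcoord q)) has_derivative (\<lambda>v. null_row_deriv M i (zcoord v) (dwcoord q v))) (at q)"
  unfolding null_row_def null_row_deriv_def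
  by (auto intro!: derivative_eq_intros zcoord_has_derivative wcoord_has_derivative)

lemma scaling_has_derivative:
  "((\<lambda>q. scaling M (zcoord q) (wcoord q)) has_derivative (\<lambda>v. scaling_deriv M (zcoord v) (dwcoord q v))) (at q)"
  unfolding scaling_def scaling_deriv_def
  by (auto intro!: derivative_eq_intros null_row_has_derivative)

lemma zrate_has_derivative:
  "((\<lambda>q. zrate M (zcoord q) (wcoord q)) has_derivative
    (\<lambda>v. dzrate M (zcoord q) (wcoord q) (zcoord v) (dwcoord q v))) (at q)"
  unfolding zrate_def dzrate_def
  by (auto intro!: derivative_eq_intros null_row_has_derivative scaling_has_derivative zcoord_has_derivative)

lemma wrate_has_derivative:
  "((\<lambda>q. wrate M (zcoord q) (wcoord q)) has_derivative
    (\<lambda>v. dwrate M (zcoord q) (wcoord q) (zcoord v) (dwcoord q v))) (at q)"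
  unfolding wrate_def dwrate_def
  by (auto intro!: derivative_eq_intros null_row_has_derivative scaling_has_derivative wcoord_has_derivative)

text \<open>The field is defined through the rate of \<open>\<zeta>\<close> and the imaginary part of the rate of \<open>w\<close>. That the
  real part is also correct says that the action is tangent to the hypersurface
  \<open>Re w = - |\<zeta>|\<^sup>2\<close>, which holds because the matrix is skew for the form.\<close>

lemma projective_field_lift:
  "zcoord (projective_field M q) = zrate M (zcoord q) (wcoord q)"
  "M \<in> su21 \<Longrightarrow> dwcoord q (projective_field M q) = wrate M (zcoord q) (wcoord q)"
proof -
  show "zcoord (projective_field M q) = zrate M (zcoord q) (wcoord q)"
    by (subst zcoord_def) (simp add: complex_eq_iff projective_field_def)
  assume "M \<in> su21"
  then obtain a b u v s where "M = su21_matrix a b u v s" by (rule su21_cases)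
  then show "dwcoord q (projective_field M q) = wrate M (zcoord q) (wcoord q)"
    by (simp add: complex_eq_iff dwcoord_def projective_field_def zrate_def wrate_def scaling_def null_row_def zcoord_def
      wcoord_def su21_matrix_def field_simps power2_eq_square)
qed

text \<open>The coordinates \<open>\<zeta>\<close> and \<open>Im w\<close> are linear on the Heisenberg group, so the bracket of two fields is
  determined by differentiating the rates of one along the other; \<open>rate_bracket\<close> evaluates
  the difference.\<close>

lemma projective_field_bracket:
  assumes M: "M \<in> su21" and N: "N \<in> su21"
  shows "projective_field (commutator M N) = vf_bracket (projective_field M) (projective_field N)"
proof -
  have sm: "smooth (projective_field M)" "smooth (projective_field N)"
    using projective_field_image M N by (auto simp: conf_heis_def)
  have lie: "lie_deriv (projective_field A) (\<lambda>q. projective_field B q $ i) q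
      = vector [Re (dzrate B (zcoord q) (wcoord q) (zrate A (zcoord q) (wcoord q)) (wrate A (zcoord q) (wcoord q))),
          Im (dzrate B (zcoord q) (wcoord q) (zrate A (zcoord q) (wcoord q)) (wrate A (zcoord q) (wcoord q))),
          - Im (dwrate B (zcoord q) (wcoord q) (zrate A (zcoord q) (wcoord q)) (wrate A (zcoord q) (wcoord q))) / 4] $ i"
    if "A \<in> su21" for A B i q
  proof -
    have "lie_deriv X (\<lambda>q. Re (zrate B (zcoord q) (wcoord q))) = (\<lambda>q. Re (dzrate B (zcoord q) (wcoord q) (zcoord (X q)) (dwcoord q (X q))))"
      "lie_deriv X (\<lambda>q. Im (zrate B (zcoord q) (wcoord q))) = (\<lambda>q. Im (dzrate B (zcoord q) (wcoord q) (zcoord (X q)) (dwcoord q (X q))))"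
      "lie_deriv X (\<lambda>q. - Im (wrate B (zcoord q) (wcoord q)) / 4) = (\<lambda>q. - Im (dwrate B (zcoord q) (wcoord q) (zcoord (X q)) (dwcoord q (X q))) / 4)"
      for X
      by (rule lie_deriv_eqI, (rule zrate_has_derivative has_derivative_Re has_derivative_Im |
          auto intro!: derivative_eq_intros wrate_has_derivative)+)+
    then show ?thesis
      using exhaust_3[of i] that by (auto simp: projective_field_def[of B] projective_field_lift)
  qed
  show ?thesis
    unfolding fun_eq_iff vec_eq_iff
  proof (intro allI)
    fix q i
    show "projective_field (commutator M N) q $ i = vf_bracket (projective_field M) (projective_field N) q $ i"
      unfolding vf_bracket_nth[OF sm] lie[OF M] lie[OF N]
      using exhaust_3[of i]
      by (auto simp: projective_field_def rate_bracket[symmetric] diff_divide_distrib)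
  qed
qed

text \<open>Only one side has to be known to be a Lie algebra: the axioms pass to the other through a
  linear bijection that respects the brackets. Hence the Jacobi identity for conformal fields
  comes from the one for matrices.\<close>

lemma lie_algebra_isomorphicI:
  fixes \<Psi> :: "'b::real_vector \<Rightarrow> 'a::real_vector"
  assumes W: "real_lie_algebra W brW" and bij: "bij_betw \<Psi> W V"
    and add: "\<And>x y. \<Psi> (x + y) = \<Psi> x + \<Psi> y" and scale: "\<And>c x. \<Psi> (c *\<^sub>R x) = c *\<^sub>R \<Psi> x"
    and br: "\<And>x y. x \<in> W \<Longrightarrow> y \<in> W \<Longrightarrow> \<Psi> (brW x y) = brV (\<Psi> x) (\<Psi> y)"
  shows "lie_algebra_isomorphic V brV W brW"
proof -
  have V: "V = \<Psi> ` W" and inj: "inj_on \<Psi> W" using bij by (auto simp: bij_betw_def)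
  have lin: "linear \<Psi>" using add scale by (rule linearI)
  have sub: "subspace W" and cl: "\<And>x y. x \<in> W \<Longrightarrow> y \<in> W \<Longrightarrow> brW x y \<in> W"
    using W by (auto simp: real_lie_algebra_def)
  note closed = subspace_add[OF sub] subspace_scale[OF sub] cl
  note Psi = add [symmetric] scale [symmetric] br [symmetric]
  have "real_lie_algebra V brV"
    unfolding real_lie_algebra_def V
  proof (intro conjI ballI allI)
    show "subspace (\<Psi> ` W)" by (rule linear_subspace_image[OF lin sub])
    fix X Y Z c assume "X \<in> \<Psi> ` W" "Y \<in> \<Psi> ` W" "Z \<in> \<Psi> ` W"
    then obtain x y z where x: "x \<in> W" "X = \<Psi> x" and y: "y \<in> W" "Y = \<Psi> y" and z: "z \<in> W" "Z = \<Psi> z"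
      by blast
    note axioms = W[unfolded real_lie_algebra_def]
    show "brV X Y \<in> \<Psi> ` W" using x y cl by (auto simp: br[symmetric])
    show "brV (X + Y) Z = brV X Z + brV Y Z" "brV X (Y + Z) = brV X Y + brV X Z"
      "brV (c *\<^sub>R X) Y = c *\<^sub>R brV X Y" "brV X (c *\<^sub>R Y) = c *\<^sub>R brV X Y"
      using x y z axioms by (simp_all add: Psi closed)
    show "brV X X = 0" using x axioms linear_0[OF lin] by (simp add: br[symmetric])
    have "brV X (brV Y Z) + brV Y (brV Z X) + brV Z (brV X Y)
        = \<Psi> (brW x (brW y z) + brW y (brW z x) + brW z (brW x y))"
      using x y z cl by (simp add: br add)
    also have "brW x (brW y z) + brW y (brW z x) + brW z (brW x y) = 0"
      using x y z axioms by blast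
    finally show "brV X (brV Y Z) + brV Y (brV Z X) + brV Z (brV X Y) = 0"
      using linear_0[OF lin] by simp
  qed
  moreover have "bij_betw (the_inv_into W \<Psi>) V W" by (rule bij_betw_the_inv_into[OF bij])
  moreover have inv: "the_inv_into W \<Psi> (\<Psi> x) = x" if "x \<in> W" for x
    by (rule the_inv_into_f_f[OF inj that])
  moreover have "\<forall>x\<in>V. \<forall>y\<in>V. the_inv_into W \<Psi> (x + y) = the_inv_into W \<Psi> x + the_inv_into W \<Psi> y"
    "\<forall>c. \<forall>x\<in>V. the_inv_into W \<Psi> (c *\<^sub>R x) = c *\<^sub>R the_inv_into W \<Psi> x"
    "\<forall>x\<in>V. \<forall>y\<in>V. the_inv_into W \<Psi> (brV x y) = brW (the_inv_into W \<Psi> x) (the_inv_into W \<Psi> y)"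
    unfolding V by (auto simp: inv closed Psi)
  ultimately show ?thesis unfolding lie_algebra_isomorphic_def using W by blast
qed

theorem theorem7p9:
  shows "lie_algebra_isomorphic conf_heis vf_bracket su21 commutator"
proof (rule lie_algebra_isomorphicI)
  show "bij_betw projective_field su21 conf_heis"
    by (simp add: bij_betw_def inj_projective_field projective_field_image)
qed (simp_all add: real_lie_algebra_su21 projective_field_add projective_field_scaleR projective_field_bracket)

end
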